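(* Let $(u^{(i)},u^{\mathrm{ref}},v^{(i)},\hat q^{(i)})_{i=1,\dots,N}$ be the solution of the closed-loop system described in the context. Then the closed-loop system is input-to-state stable in the max-norm with respect to the inputs $f^{(i)},d^{(i)}_0,d^{(i)}_1,r,q^{(i)}$; namely, for arbitrary $\sigma\in(0,\lambda)$, every $i\in\{1,\dots,N\}$ and every $t>0$, $$\begin{aligned}&\left\|u^{(i)}(\cdot,t)\right\|_{C([0,1])}+\left\|u^{\mathrm{ref}}(\cdot,t)\right\|_{C([0,1])}+\left\|v^{(i)}(\cdot,t)\right\|_{C([0,1])}+\left\|\hat q^{(i)}(\cdot,t)\right\|_{C([0,1])}\\ \le{}&\left(1+2\widetilde{\mathcal C}_i\right)e^{-\sigma t}\left(2\max_n\left\|u^{(n)}_0\right\|_{C([0,1])}+\left\|u^{\mathrm{ref}}_0\right\|_{C([0,1])}\right)\\&+\left(4+2\widetilde{\mathcal C}_i\right)e^{-\sigma t}\left(\max_n\left\|v^{(n)}_0\right\|_{C([0,1])}+\max_n\left\|\hat q^{(n)}_0\right\|_{C([0,1])}\right)\\&+3\left\|r\right\|_{C([0,t])}+2\left\|q^{(i)}\right\|_{C([0,t])}+\left(1+2\widetilde{\mathcal C}_i\right)\mathcal D(t),\end{aligned}$$ where $n$ ranges over $\{1,\dots,N\}$ and $$\mathcal D(t)=\frac{2}{\lambda-\sigma}\max_{n}\left\|f^{(n)}\right\|_{C(\overline Q_t)}+\max_n\left\|d^{(n)}_0\right\|_{C([0,t])}+\frac1l\max_n\left\|d^{(n)}_1\right\|_{C([0,t])},$$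 $$\widetilde{\mathcal C}_i=1+\frac{k_i}{l}\,\mathcal C_{i-1},\qquad \mathcal C_i=\frac{\mathcal M_i}{1-\mathcal N},\qquad \mathcal N=\frac{\prod_{n=1}^N k_n}{l^N},$$ $$\mathcal M_i=1+\sum_{m=1}^{i}\frac{\prod_{r=0}^{m-1}k_{i-r}}{l^m}+\sum_{m=i+1}^{N-1}\frac{\left(\prod_{r=0}^{i-1}k_{i-r}\right)\left(\prod_{s=0}^{m-i-1}k_{N-s}\right)}{l^m}.$$
   Context: Notation: $\mathbb{R}_{\ge0}=[0,\infty)$, $\mathbb{R}_{>0}=(0,\infty)$, $Q_\infty=(0,1)\times\mathbb{R}_{>0}$, $\overline Q_\infty=[0,1]\times\mathbb{R}_{\ge0}$, $\overline Q_t=[0,1]\times[0,t]$. $\|h\|_{C(K)}=\max_{K}|h|$ for continuous $h$ on a compact set $K$. Subscripts $t,x$ denote partial derivatives. $N\ge2$ is an integer; $i$ ranges over $\{1,\dots,N\}$; any nonpositive index $m$ is read as $m+N$ (so $u^{(0)}=u^{(N)}$, $\mathcal C_0=\mathcal C_N$, etc.); empty sums are $0$. (In the product defining $\mathcal M_i$, $r$ is a dummy index, not the reference signal.) Constants: $\alpha>0$, $\lambda>0$, $l>0$, and gains $k_i\in(0,l)$. Closed-loop system, for $(x,t)\in Q_\infty$ (boundary conditions for $t>0$, initial conditions for $x\in(0,1)$): Agents: $u^{(i)}_t=\alpha u^{(i)}_{xx}-\lambda u^{(i)}+f^{(i)}$, $u^{(i)}(0,t)=q^{(i)}(t)+U^{(i)}_0(t)$,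 $u^{(i)}_x(1,t)=-l\,u^{(i)}(1,t)+U^{(i)}_1(t)$, $u^{(i)}(x,0)=u^{(i)}_0(x)$. Reference: $u^{\mathrm{ref}}_t=\alpha u^{\mathrm{ref}}_{xx}-\lambda u^{\mathrm{ref}}$, $u^{\mathrm{ref}}(0,t)=r(t)$, $u^{\mathrm{ref}}_x(1,t)=-l\,u^{\mathrm{ref}}(1,t)$, $u^{\mathrm{ref}}(x,0)=u^{\mathrm{ref}}_0(x)$. Auxiliary system: $v^{(i)}_t=\alpha v^{(i)}_{xx}-\lambda v^{(i)}$, $v^{(i)}(0,t)=U^{(i)}_0(t)$, $v^{(i)}_x(1,t)=-l\,v^{(i)}(1,t)+U^{(i)}_1(t)$, $v^{(i)}(x,0)=v^{(i)}_0(x)$. Disturbance observer: $\hat q^{(i)}_t=\alpha\hat q^{(i)}_{xx}-\lambda\hat q^{(i)}$, $\hat q^{(i)}_x(0,t)=u^{(i)}_x(0,t)-v^{(i)}_x(0,t)$, $\hat q^{(i)}_x(1,t)=-l\,\hat q^{(i)}(1,t)$, $\hat q^{(i)}(x,0)=\hat q^{(i)}_0(x)$. Control laws: $U^{(i)}_0(t)=r(t)-\hat q^{(i)}(0,t)+d^{(i)}_0(t)$ and $U^{(i)}_1(t)=k_i\big(u^{(i-1)}(1,t)-u^{\mathrm{ref}}(1,t)\big)+d^{(i)}_1(t)$. Write $\widetilde u^{(i)}_0=u^{(i)}_0-u^{\mathrm{ref}}_0$. Standing assumptions: $f^{(i)}\in C(\overline Q_\infty)$; $d^{(i)}_0,d^{(i)}_1,q^{(i)},r\in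 C^1(\mathbb{R}_{\ge0})$; $\widetilde u^{(i)}_0,u^{\mathrm{ref}}_0,v^{(i)}_0\in H^2(0,1)\cap C([0,1])$; and the compatibility conditions $\widetilde u^{(i)}_0(0)=q^{(i)}(0)+d^{(i)}_0(0)-\hat q^{(i)}_0(0)$, $\widetilde u^{(i)}_{0x}(1)=-l\,\widetilde u^{(i)}_0(1)+k_i\widetilde u^{(i-1)}_0(1)+d^{(i)}_1(0)$, $u^{\mathrm{ref}}_0(0)=r(0)$, $u^{\mathrm{ref}}_{0x}(1)=-l\,u^{\mathrm{ref}}_0(1)$, $v^{(i)}_0(0)=U^{(i)}_0(0)$, $v^{(i)}_{0x}(1)=-l\,v^{(i)}_0(1)+U^{(i)}_1(0)$. The solution is a classical one, each component belonging to $C(\mathbb{R}_{\ge0};H^2(0,1))\cap C^1(\mathbb{R}_{\ge0};L^2(0,1))$. *)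

theory Defs
  imports "HOL-Analysis.Analysis"
begin

section \<open>Sobolev spaces on \<open>(0,1)\<close>\<close>

abbreviation leb01 :: "real measure" where
  "leb01 \<equiv> lebesgue_on {0<..<1}"

definition L2 :: "(real \<Rightarrow> real) set" where
  "L2 = {g. g \<in> borel_measurable leb01 \<and> integrable leb01 (\<lambda>x. (g x)\<^sup>2)}"

definition L2_norm :: "(real \<Rightarrow> real) \<Rightarrow> real" where
  "L2_norm g = sqrt (\<integral>x. (g x)\<^sup>2 \<partial>leb01)"

text \<open>Test functions are the compactly supported \<open>C\<^sup>1\<close> functions on \<open>(0,1)\<close>, as in
  Brezis, Functional Analysis, Sobolev Spaces and Partial Differential Equations, Chapter 8.\<close>

definition test_fun :: "(real \<Rightarrow> real) \<Rightarrow> bool" where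
  "test_fun \<phi> \<longleftrightarrow> \<phi> C1_differentiable_on UNIV \<and>
     (\<exists>K. compact K \<and> K \<subseteq> {0<..<1} \<and> (\<forall>x. x \<notin> K \<longrightarrow> \<phi> x = 0))"

definition has_weak_deriv :: "(real \<Rightarrow> real) \<Rightarrow> (real \<Rightarrow> real) \<Rightarrow> bool" where
  "has_weak_deriv h g \<longleftrightarrow>
     (\<forall>\<phi>. test_fun \<phi> \<longrightarrow> (\<integral>x. h x * deriv \<phi> x \<partial>leb01) = - (\<integral>x. g x * \<phi> x \<partial>leb01))"

definition H1 :: "(real \<Rightarrow> real) set" where
  "H1 = {h \<in> L2. \<exists>g\<in>L2. has_weak_deriv h g}"

text \<open>The weak derivative is determined only up to a null set; on \<open>H1\<close> the operator below picks
  some representative of it.\<close>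

definition weak_deriv :: "(real \<Rightarrow> real) \<Rightarrow> real \<Rightarrow> real" where
  "weak_deriv h = (SOME g. g \<in> L2 \<and> has_weak_deriv h g)"

definition H2 :: "(real \<Rightarrow> real) set" where
  "H2 = {h \<in> H1. weak_deriv h \<in> H1}"

definition H2_norm :: "(real \<Rightarrow> real) \<Rightarrow> real" where
  "H2_norm h = sqrt ((L2_norm h)\<^sup>2 + (L2_norm (weak_deriv h))\<^sup>2
                       + (L2_norm (weak_deriv (weak_deriv h)))\<^sup>2)"

text \<open>The derivative at a point of \<open>[0,1]\<close>, one-sided at the end points. It exists for every
  continuous representative of an element of \<open>H2\<close>, since \<open>H\<^sup>2(0,1) \<subseteq> C\<^sup>1([0,1])\<close>.\<close>

definition dx :: "(real \<Rightarrow> real) \<Rightarrow> real \<Rightarrow> real" where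
  "dx h x = vector_derivative h (at x within {0..1})"

section \<open>The solution class and the equation\<close>

text \<open>A function \<open>u x t\<close> is regarded as the curve \<open>t \<mapsto> u(\<cdot>,t)\<close>, defined for \<open>t \<ge> 0\<close>;
  limits in time at \<open>0\<close> are therefore one-sided.\<close>

definition has_L2_time_deriv :: "(real \<Rightarrow> real \<Rightarrow> real) \<Rightarrow> (real \<Rightarrow> real) \<Rightarrow> real \<Rightarrow> bool" where
  "has_L2_time_deriv u w t \<longleftrightarrow> w \<in> L2 \<and>
     ((\<lambda>s. L2_norm (\<lambda>x. (u x s - u x t) / (s - t) - w x)) \<longlongrightarrow> 0) (at t within {0..})"

definition time_deriv :: "(real \<Rightarrow> real \<Rightarrow> real) \<Rightarrow> real \<Rightarrow> real \<Rightarrow> real" where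
  "time_deriv u x t = (SOME w. has_L2_time_deriv u w t) x"

definition C_H2 :: "(real \<Rightarrow> real \<Rightarrow> real) set" where
  "C_H2 = {u. (\<forall>t\<ge>0. (\<lambda>x. u x t) \<in> H2) \<and>
     (\<forall>t\<ge>0. ((\<lambda>s. H2_norm (\<lambda>x. u x s - u x t)) \<longlongrightarrow> 0) (at t within {0..}))}"

definition C1_L2 :: "(real \<Rightarrow> real \<Rightarrow> real) set" where
  "C1_L2 = {u. (\<forall>t\<ge>0. (\<lambda>x. u x t) \<in> L2) \<and>
     (\<forall>t\<ge>0. \<exists>w. has_L2_time_deriv u w t) \<and>
     (\<forall>t\<ge>0. ((\<lambda>s. L2_norm (\<lambda>x. time_deriv u x s - time_deriv u x t)) \<longlongrightarrow> 0)
                (at t within {0..}))}"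

text \<open>The continuity requirement says that \<open>u(\<cdot>,t)\<close> is the continuous representative of its
  class in \<open>H\<^sup>2(0,1)\<close>, so that its max-norm and its boundary values are meaningful.\<close>

definition regular :: "(real \<Rightarrow> real \<Rightarrow> real) \<Rightarrow> bool" where
  "regular u \<longleftrightarrow> u \<in> C_H2 \<inter> C1_L2 \<and> (\<forall>t\<ge>0. continuous_on {0..1} (\<lambda>x. u x t))"

text \<open>\<open>u\<^sub>t = \<alpha> u\<^sub>x\<^sub>x - lam u + f\<close>, as an equality in \<open>L\<^sup>2(0,1)\<close> at every time \<open>t > 0\<close>.\<close>

definition solves_pde ::
    "real \<Rightarrow> real \<Rightarrow> (real \<Rightarrow> real \<Rightarrow> real) \<Rightarrow> (real \<Rightarrow> real \<Rightarrow> real) \<Rightarrow> bool" where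
  "solves_pde \<alpha> lam f u \<longleftrightarrow> (\<forall>t>0. AE x in leb01.
     time_deriv u x t = \<alpha> * weak_deriv (weak_deriv (\<lambda>y. u y t)) x - lam * u x t + f x t)"

section \<open>Inputs, norms and constants\<close>

definition C1_halfline :: "(real \<Rightarrow> real) set" where
  "C1_halfline = {g. \<exists>g'. (\<forall>t\<ge>0. (g has_real_derivative g' t) (at t within {0..})) \<and>
     continuous_on {0..} g'}"

text \<open>Intended for continuous \<open>h\<close> and compact nonempty \<open>K\<close>, where the supremum is a maximum.\<close>

definition C_norm :: "'a set \<Rightarrow> ('a \<Rightarrow> real) \<Rightarrow> real" where
  "C_norm K h = (SUP z\<in>K. \<bar>h z\<bar>)"

text \<open>Agents are numbered \<open>1,\<dots>,N\<close>, and the index \<open>0\<close> is read as \<open>N\<close>.\<close>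

definition cyc :: "nat \<Rightarrow> nat \<Rightarrow> nat" where
  "cyc N m = (if m = 0 then N else m)"

definition loop_gain :: "nat \<Rightarrow> real \<Rightarrow> (nat \<Rightarrow> real) \<Rightarrow> real" where
  "loop_gain N l k = (\<Prod>n=1..N. k n) / l ^ N"

definition M_const :: "nat \<Rightarrow> real \<Rightarrow> (nat \<Rightarrow> real) \<Rightarrow> nat \<Rightarrow> real" where
  "M_const N l k i =
     1 + (\<Sum>m=1..i. (\<Prod>j=0..m-1. k (i - j)) / l ^ m)
       + (\<Sum>m=i+1..N-1. (\<Prod>j=0..i-1. k (i - j)) * (\<Prod>s=0..m-i-1. k (N - s)) / l ^ m)"

definition C_const :: "nat \<Rightarrow> real \<Rightarrow> (nat \<Rightarrow> real) \<Rightarrow> nat \<Rightarrow> real" where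
  "C_const N l k i = M_const N l k i / (1 - loop_gain N l k)"

definition Ct_const :: "nat \<Rightarrow> real \<Rightarrow> (nat \<Rightarrow> real) \<Rightarrow> nat \<Rightarrow> real" where
  "Ct_const N l k i = 1 + k i / l * C_const N l k (cyc N (i - 1))"

definition D_term :: "nat \<Rightarrow> real \<Rightarrow> real \<Rightarrow> real \<Rightarrow> (nat \<Rightarrow> real \<Rightarrow> real \<Rightarrow> real) \<Rightarrow>
    (nat \<Rightarrow> real \<Rightarrow> real) \<Rightarrow> (nat \<Rightarrow> real \<Rightarrow> real) \<Rightarrow> real \<Rightarrow> real" where
  "D_term N l lam \<sigma> f d0 d1 t =
     2 / (lam - \<sigma>) * (MAX n\<in>{1..N}. C_norm ({0..1} \<times> {0..t}) (\<lambda>(x, s). f n x s))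
     + (MAX n\<in>{1..N}. C_norm {0..t} (d0 n))
     + 1 / l * (MAX n\<in>{1..N}. C_norm {0..t} (d1 n))"

end

theory Submission
  imports Defs
begin

text \<open>The decay estimate behind everything is a truncation argument: if \<open>u\<close> solves the heat equation
  with damping \<open>lam\<close>, then \<open>z = u - K exp(-\<sigma> t)\<close> is a subsolution for suitable \<open>K\<close>, and for a convex \<open>\<phi>\<close> vanishing
  exactly on \<open>(-\<infinity>, 0]\<close> the energy \<open>\<integral> \<phi>(z(x,t)) dx\<close> does not increase, so it stays \<open>0\<close>.
  The error \<open>e = u - v - qh\<close> satisfies a problem with homogeneous boundary conditions and
  \<open>e(0,t) = q - qh(0,t)\<close>, so it decays up to the effect of \<open>f\<close>. Hence each \<open>u - uref\<close> is
  controlled by the data plus \<open>k\<^sub>i / l\<close> times the boundary value of its predecessor; going once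
  around the cycle closes the estimate because the loop gain is below \<open>1\<close>.
  The estimates for \<open>u\<close>, \<open>v\<close> and \<open>qh\<close> are then taken directly from their own boundary conditions,
  not through the triangle inequality, which would give worse constants.\<close>

section \<open>Integration by parts with an absolutely continuous factor\<close>

text \<open>The obstacle is regularity: second space derivatives and time derivatives are given only
  in \<open>L2\<close>, through test functions and through limits of difference quotients, whereas
  the energy argument needs boundary fluxes and a chain rule in time. The first half therefore
  recovers C1 functions from weak derivatives. It works with primitives throughout, so that almost
  everywhere differentiability of integrals never enters. On the constants: the function K
  exp(-\<sigma> t) solves the equation with source (lam - \<sigma>) K exp(-\<sigma> t) and has Robin
  value l K exp(-\<sigma> t) at x = 1. Hence a source bounded by F requires F / (lam - \<sigma>) of
  K, and a Robin input bounded by D1 requires D1 / l. The inputs do not decay, so the final time t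
  is frozen and their norms enter K with the factor exp(\<sigma> t), which cancels at that time; the
  initial data enter without it and keep exp(-\<sigma> t).\<close>

lemma indefinite_integral_diff:
  fixes g G :: "real \<Rightarrow> real"
  assumes G: "\<And>x. x \<in> {a..b} \<Longrightarrow> (g has_integral (G x - G a)) {a..x}"
    and xy: "a \<le> x" "x \<le> y" "y \<le> b"
  shows "(g has_integral (G y - G x)) {x..y}"
proof -
  have "g integrable_on {a..y}" using G[of y] xy by (auto simp: has_integral_iff)
  then have i: "g integrable_on {x..y}" using xy by (auto intro: integrable_on_subinterval)
  then have "integral {a..x} g + integral {x..y} g = integral {a..y} g"
    using \<open>g integrable_on {a..y}\<close> xy by (intro Henstock_Kurzweil_Integration.integral_combine) auto
  moreover have "integral {a..x} g = G x - G a" "integral {a..y} g = G y - G a"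
    using G[of x] G[of y] xy by (auto intro: integral_unique)
  ultimately have "integral {x..y} g = G y - G x" by simp
  with i show ?thesis by (simp add: has_integral_iff)
qed

text \<open>\<open>G\<close> is differentiable only almost everywhere, so the product rule is not
  applied to it. Instead the defect of the formula on \<open>{a..x}\<close> has derivative 0 at
  every x: its increment is at most the length of the step times the increment of the continuous
  function \<open>V\<close>, the total variation of \<open>G\<close>, up to a constant.\<close>

lemma has_integral_by_parts_indefinite:
  fixes g G p p' :: "real \<Rightarrow> real"
  assumes ab: "a \<le> b"
    and g: "g absolutely_integrable_on {a..b}"
    and G: "\<And>x. x \<in> {a..b} \<Longrightarrow> (g has_integral (G x - G a)) {a..x}"
    and p: "\<And>x. x \<in> {a..b} \<Longrightarrow> (p has_real_derivative p' x) (at x within {a..b})"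
    and p'c: "continuous_on {a..b} p'"
  shows "((\<lambda>x. g x * p x) has_integral
           (G b * p b - G a * p a - integral {a..b} (\<lambda>x. G x * p' x))) {a..b}"
proof -
  have Vint: "(\<lambda>x. \<bar>g x\<bar>) integrable_on {a..b}" and gint: "g integrable_on {a..b}"
    using g by (auto simp: absolutely_integrable_on_def)
  define V where "V x = integral {a..x} (\<lambda>x. \<bar>g x\<bar>)" for x
  have Vc: "continuous_on {a..b} V"
    unfolding V_def using Vint by (rule indefinite_integral_continuous_1)
  have pc: "continuous_on {a..b} p"
    unfolding continuous_on_eq_continuous_within using p by (blast intro: DERIV_continuous)
  have Gc: "continuous_on {a..b} G"
  proof -
    have "continuous_on {a..b} (\<lambda>x. G a + integral {a..x} g)"
      using gint by (intro continuous_intros indefinite_integral_continuous_1)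
    moreover have "G a + integral {a..x} g = G x" if "x \<in> {a..b}" for x
      using G[OF that] by (simp add: integral_unique)
    ultimately show ?thesis by (metis (no_types, lifting) continuous_on_cong)
  qed
  have gp: "(\<lambda>x. g x * p x) integrable_on {a..b}"
  proof -
    have "(\<lambda>x. p x * g x) absolutely_integrable_on {a..b}"
      using g pc by (intro absolutely_integrable_bounded_measurable_product_real)
       (auto intro!: continuous_imp_measurable_on_sets_lebesgue compact_imp_bounded
          compact_continuous_image)
    then show ?thesis by (auto simp: absolutely_integrable_on_def mult.commute)
  qed
  have Gp': "(\<lambda>x. G x * p' x) integrable_on {a..b}"
    using Gc p'c by (intro integrable_continuous_real continuous_intros)
  obtain L where L: "\<And>x. x \<in> {a..b} \<Longrightarrow> \<bar>p' x\<bar> \<le> L" and L0: "L \<ge> 0"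
  proof -
    have "bounded (p' ` {a..b})" using p'c by (intro compact_imp_bounded compact_continuous_image) auto
    then obtain L where "\<forall>x\<in>{a..b}. \<bar>p' x\<bar> \<le> L" by (auto simp: bounded_iff)
    then show ?thesis using that[of "max L 0"] by force
  qed
  \<comment> \<open>The formula on \<open>{a..x}\<close> says that \<open>E x\<close> keeps its
    initial value \<open>- G a * p a\<close>.\<close>
  define E where "E x = integral {a..x} (\<lambda>x. g x * p x) - G x * p x + integral {a..x} (\<lambda>x. G x * p' x)" for x
  have pdiff: "(p' has_integral (p y - p x)) {x..y}" if "a \<le> x" "x \<le> y" "y \<le> b" for x y
  proof (rule fundamental_theorem_of_calculus)
    fix z assume "z \<in> {x..y}"
    then show "(p has_vector_derivative p' z) (at z within {x..y})"
      using p[of z] that has_vector_derivative_within_subset[of p "p' z" z "{a..b}" "{x..y}"]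
      by (auto simp: has_real_derivative_iff_has_vector_derivative)
  qed (use that in auto)
  have main: "\<bar>E y - E x\<bar> \<le> 2 * L * \<bar>y - x\<bar> * \<bar>V y - V x\<bar>" if xy: "a \<le> x" "x \<le> y" "y \<le> b" for x y
  proof -
    have sub: "f integrable_on {x..y}" if "f integrable_on {a..b}" for f :: "real \<Rightarrow> real"
      using that xy by (auto intro: integrable_on_subinterval)
    have comb: "integral {a..y} f - integral {a..x} f = integral {x..y} f"
      if "f integrable_on {a..b}" for f :: "real \<Rightarrow> real"
      using Henstock_Kurzweil_Integration.integral_combine[of a x y f] xy integrable_on_subinterval[OF that, of a y] by auto
    have VV: "V y - V x = integral {x..y} (\<lambda>s. \<bar>g s\<bar>)" unfolding V_def using comb[OF Vint] .
    have gxy: "(g has_integral (G y - G x)) {x..y}"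
      using indefinite_integral_diff[OF G] xy by auto
    \<comment> \<open>Anchoring \<open>p\<close> at y and \<open>G\<close> at x turns the increment
      of \<open>E\<close> into the integral of
      \<open>g s * (p s - p y) + (G s - G x) * p' s\<close>. Each summand then contains one factor
      that is small by itself, besides the short interval or the small integral of
      \<open>\<bar>g\<bar>\<close>.\<close>
    have "((\<lambda>s. g s * p s - g s * p y + (G s * p' s - G x * p' s)) has_integral
        (integral {x..y} (\<lambda>s. g s * p s) - (G y - G x) * p y +
          (integral {x..y} (\<lambda>s. G s * p' s) - G x * (p y - p x)))) {x..y}"
      by (intro has_integral_add has_integral_diff has_integral_mult_left has_integral_mult_right
          gxy pdiff xy integrable_integral sub gp Gp')
    moreover have "integral {x..y} (\<lambda>s. g s * p s) - (G y - G x) * p y +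
          (integral {x..y} (\<lambda>s. G s * p' s) - G x * (p y - p x)) = E y - E x"
      unfolding E_def using comb[OF gp] comb[OF Gp'] by (simp add: algebra_simps)
    ultimately have hi: "((\<lambda>s. g s * p s - g s * p y + (G s * p' s - G x * p' s)) has_integral (E y - E x)) {x..y}"
      by simp
    have hb: "((\<lambda>s. \<bar>g s\<bar> * (L * (y - x)) + (V y - V x) * L) has_integral
        ((V y - V x) * (L * (y - x)) + (V y - V x) * L * (y - x))) {x..y}"
      unfolding VV using has_integral_const_real[of "integral {x..y} (\<lambda>s. \<bar>g s\<bar>) * L" x y] xy
      by (intro has_integral_add has_integral_mult_left integrable_integral sub Vint)
         (simp add: mult_ac)
    have "\<bar>E y - E x\<bar> \<le> (V y - V x) * (L * (y - x)) + (V y - V x) * L * (y - x)"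
    proof -
      have "norm (g s * p s - g s * p y + (G s * p' s - G x * p' s))
          \<le> \<bar>g s\<bar> * (L * (y - x)) + (V y - V x) * L" if s: "s \<in> {x..y}" for s
      proof -
        have "\<bar>p s - p y\<bar> \<le> L * (y - x)"
        proof -
          have "(p' has_integral (p y - p s)) {s..y}" using s xy by (intro pdiff) auto
          then have "\<bar>p y - p s\<bar> \<le> L * (y - s)"
            using has_integral_bound_real[of L "{}" p' "p y - p s" s y] L L0 s xy by auto
          also have "\<dots> \<le> L * (y - x)" using s L0 by (intro mult_left_mono) auto
          finally show ?thesis by simp
        qed
        moreover have "\<bar>G s - G x\<bar> \<le> V y - V x"
        proof -
          have "(g has_integral (G s - G x)) {x..s}"
            using s xy by (intro indefinite_integral_diff[OF G]) auto
          then have "\<bar>G s - G x\<bar> \<le> integral {x..s} (\<lambda>s. \<bar>g s\<bar>)"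
            using integral_norm_bound_integral[of g "{x..s}" "\<lambda>s. \<bar>g s\<bar>"]
              integrable_on_subinterval[OF Vint, of x s] s xy
            by (auto simp: has_integral_iff)
          also have "\<dots> \<le> integral {x..y} (\<lambda>s. \<bar>g s\<bar>)"
            using integrable_on_subinterval[OF Vint] s xy by (intro integral_subset_le) auto
          finally show ?thesis by (simp add: VV)
        qed
        moreover have "\<bar>p' s\<bar> \<le> L" using L s xy by auto
        ultimately have "\<bar>g s\<bar> * \<bar>p s - p y\<bar> + \<bar>G s - G x\<bar> * \<bar>p' s\<bar>
            \<le> \<bar>g s\<bar> * (L * (y - x)) + (V y - V x) * L"
          by (intro add_mono mult_mono) auto
        moreover have "norm (g s * p s - g s * p y + (G s * p' s - G x * p' s))
          \<le> \<bar>g s\<bar> * \<bar>p s - p y\<bar> + \<bar>G s - G x\<bar> * \<bar>p' s\<bar>"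
        proof -
          have eq: "g s * p s - g s * p y + (G s * p' s - G x * p' s)
              = g s * (p s - p y) + (G s - G x) * p' s" by (simp add: algebra_simps)
          show ?thesis unfolding eq by (metis abs_mult abs_triangle_ineq real_norm_def)
        qed
        ultimately show ?thesis by linarith
      qed
      then show ?thesis
        using integral_norm_bound_integral[of "\<lambda>s. g s * p s - g s * p y + (G s * p' s - G x * p' s)" "{x..y}"
            "\<lambda>s. \<bar>g s\<bar> * (L * (y - x)) + (V y - V x) * L"] hi hb
        by (auto simp: has_integral_iff)
    qed
    also have "\<dots> = 2 * L * \<bar>y - x\<bar> * (V y - V x)" using xy by (simp add: algebra_simps)
    also have "\<dots> \<le> 2 * L * \<bar>y - x\<bar> * \<bar>V y - V x\<bar>" using L0 by (intro mult_left_mono) auto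
    finally show ?thesis .
  qed
  have main': "\<bar>E y - E x\<bar> \<le> 2 * L * \<bar>y - x\<bar> * \<bar>V y - V x\<bar>" if "x \<in> {a..b}" "y \<in> {a..b}" for x y
  proof (cases "x \<le> y")
    case True then show ?thesis using main that by auto
  next
    case False
    then show ?thesis using main[of y x] that by (simp add: abs_minus_commute)
  qed
  have "(E has_real_derivative 0) (at x within {a..b})" if x: "x \<in> {a..b}" for x
  proof -
    have "((\<lambda>y. 2 * L * \<bar>V y - V x\<bar>) \<longlongrightarrow> 2 * L * \<bar>V x - V x\<bar>) (at x within {a..b})"
      using Vc x by (intro tendsto_intros) (auto simp: continuous_on_def)
    then have lim: "((\<lambda>y. 2 * L * \<bar>V y - V x\<bar>) \<longlongrightarrow> 0) (at x within {a..b})" by simp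
    have "\<forall>\<^sub>F y in at x within {a..b}. norm ((E y - E x) / (y - x)) \<le> 2 * L * \<bar>V y - V x\<bar>"
      unfolding eventually_at_filter using main'[OF x]
      by (intro always_eventually) (auto simp: divide_simps mult_ac)
    then show ?thesis
      unfolding has_field_derivative_iff by (rule Lim_null_comparison[OF _ lim])
  qed
  then have "E b = E a"
    using has_field_derivative_zero_constant[of "{a..b}" E] ab by auto
  then have "integral {a..b} (\<lambda>x. g x * p x) =
     G b * p b - G a * p a - integral {a..b} (\<lambda>x. G x * p' x)"
    unfolding E_def by simp
  with gp show ?thesis by (simp add: has_integral_iff)
qed

section \<open>Square-integrable functions on the unit interval\<close>

lemma finite_measure_leb01: "finite_measure leb01"
  by (rule finite_measureI) (simp add: emeasure_restrict_space space_restrict_space)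

interpretation leb01: finite_measure leb01
  by (rule finite_measure_leb01)

text \<open>Weak derivatives are tested with the Lebesgue integral over the open interval, while
  primitives use the gauge integral over the closed one. This and \<open>integral_leb01\<close> pass
  between them.\<close>

lemma integrable_leb01_iff:
  fixes g :: "real \<Rightarrow> real"
  shows "integrable leb01 g \<longleftrightarrow> g absolutely_integrable_on {0..1}"
  by (subst absolutely_integrable_on_Icc_iff_Ioo)
     (simp add: integrable_restrict_space set_integrable_def)

lemma integral_leb01:
  fixes g :: "real \<Rightarrow> real"
  assumes "integrable leb01 g"
  shows "integral\<^sup>L leb01 g = integral {0..1} g"
  using assms by (simp add: lebesgue_integral_eq_integral integral_open_interval_real)

lemma measurable_leb01_continuous:
  fixes h :: "real \<Rightarrow> real"
  assumes "continuous_on {0..1} h"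
  shows "h \<in> borel_measurable leb01"
  using assms by (intro continuous_imp_measurable_on_sets_lebesgue) (auto intro: continuous_on_subset)

lemma integrable_leb01_continuous:
  fixes h :: "real \<Rightarrow> real"
  assumes "continuous_on {0..1} h"
  shows "integrable leb01 h"
  using assms by (simp add: integrable_leb01_iff absolutely_integrable_continuous_real)

lemma L2_continuous:
  assumes "continuous_on {0..1} h"
  shows "h \<in> L2"
  unfolding L2_def using assms measurable_leb01_continuous[OF assms]
    integrable_leb01_continuous[OF continuous_on_power[OF assms, of 2]]
  by simp

lemma L2_integrable: "f \<in> L2 \<Longrightarrow> integrable leb01 f"
  unfolding L2_def by (blast intro: leb01.square_integrable_imp_integrable)

lemma L2_sq_integrable: "f \<in> L2 \<Longrightarrow> integrable leb01 (\<lambda>x. (f x)\<^sup>2)"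
  unfolding L2_def by blast

lemma L2_measurable: "f \<in> L2 \<Longrightarrow> f \<in> borel_measurable leb01"
  unfolding L2_def by blast

lemma L2_product_integrable:
  assumes "f \<in> L2" "g \<in> L2"
  shows "integrable leb01 (\<lambda>x. f x * g x)"
proof (rule Bochner_Integration.integrable_bound)
  show "integrable leb01 (\<lambda>x. (f x)\<^sup>2 + (g x)\<^sup>2)"
    using assms L2_sq_integrable by auto
  show "(\<lambda>x. f x * g x) \<in> borel_measurable leb01"
    using assms L2_measurable by auto
  have "\<bar>f x * g x\<bar> \<le> (f x)\<^sup>2 + (g x)\<^sup>2" for x
  proof -
    have "2 * \<bar>f x * g x\<bar> \<le> (f x)\<^sup>2 + (g x)\<^sup>2"
      using sum_squares_bound[of "\<bar>f x\<bar>" "\<bar>g x\<bar>"] by (simp add: abs_mult mult_ac)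
    then show ?thesis by (smt (verit) zero_le_power2)
  qed
  then show "AE x in leb01. norm (f x * g x) \<le> norm ((f x)\<^sup>2 + (g x)\<^sup>2)"
    by (intro AE_I2) auto
qed

lemma L2_lincomb:
  assumes "f \<in> L2" "g \<in> L2"
  shows "(\<lambda>x. a * f x + b * g x) \<in> L2"
proof -
  have "integrable leb01 (\<lambda>x. a\<^sup>2 * (f x)\<^sup>2 + (2 * a * b) * (f x * g x) + b\<^sup>2 * (g x)\<^sup>2)"
    using assms L2_sq_integrable L2_product_integrable by auto
  moreover have "(a * f x + b * g x)\<^sup>2 = a\<^sup>2 * (f x)\<^sup>2 + (2 * a * b) * (f x * g x) + b\<^sup>2 * (g x)\<^sup>2" for x
    by (simp add: power2_eq_square algebra_simps)
  ultimately show ?thesis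
    unfolding L2_def using assms[THEN L2_measurable] by auto
qed

lemma L2_norm_nonneg: "L2_norm f \<ge> 0"
  unfolding L2_norm_def by (intro real_sqrt_ge_zero integral_nonneg_AE) auto

lemma L2_norm_power2: "(L2_norm f)\<^sup>2 = (\<integral>x. (f x)\<^sup>2 \<partial>leb01)"
  unfolding L2_norm_def by (intro real_sqrt_pow2 integral_nonneg_AE) auto

text \<open>A crude form of Minkowski's inequality, from (A + B)^2 \<le> 2 A^2 + 2 B^2. It serves
  only to bound norms and to show that they tend to 0, where the factor 2 is harmless.\<close>

lemma L2_norm_lincomb_le:
  assumes "f \<in> L2" "g \<in> L2"
  shows "L2_norm (\<lambda>x. a * f x + b * g x) \<le> sqrt (2 * a\<^sup>2 * (L2_norm f)\<^sup>2 + 2 * b\<^sup>2 * (L2_norm g)\<^sup>2)"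
proof -
  have "(\<integral>x. (a * f x + b * g x)\<^sup>2 \<partial>leb01) \<le> (\<integral>x. 2 * a\<^sup>2 * (f x)\<^sup>2 + 2 * b\<^sup>2 * (g x)\<^sup>2 \<partial>leb01)"
  proof (rule integral_mono)
    fix x
    show "(a * f x + b * g x)\<^sup>2 \<le> 2 * a\<^sup>2 * (f x)\<^sup>2 + 2 * b\<^sup>2 * (g x)\<^sup>2"
      using sum_squares_bound[of "a * f x" "b * g x"] by (simp add: power2_sum power_mult_distrib)
  qed (use assms L2_lincomb L2_sq_integrable in auto)
  also have "\<dots> = 2 * a\<^sup>2 * (L2_norm f)\<^sup>2 + 2 * b\<^sup>2 * (L2_norm g)\<^sup>2"
    using assms[THEN L2_sq_integrable] by (simp add: L2_norm_power2)
  finally show ?thesis by (simp add: L2_norm_def)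
qed

lemma measure_leb01: "measure leb01 {0<..<1} = 1"
  by (simp add: measure_restrict_space)

lemma integral_leb01_const: "(\<integral>x. c \<partial>leb01) = (c::real)"
  using measure_leb01 by (simp add: space_restrict_space)

text \<open>The interval has measure 1, so this is the nonnegativity of the variance of
  \<open>\<bar>f\<bar>\<close>.\<close>

lemma integral_abs_le_L2_norm:
  assumes "f \<in> L2"
  shows "(\<integral>x. \<bar>f x\<bar> \<partial>leb01) \<le> L2_norm f"
proof -
  define m where "m = (\<integral>x. \<bar>f x\<bar> \<partial>leb01)"
  have "0 \<le> (\<integral>x. (\<bar>f x\<bar> - m)\<^sup>2 \<partial>leb01)" by simp
  also have "\<dots> = (\<integral>x. (f x)\<^sup>2 - 2 * m * \<bar>f x\<bar> + m\<^sup>2 \<partial>leb01)"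
    by (simp add: power2_diff algebra_simps)
  also have "\<dots> = (L2_norm f)\<^sup>2 - 2 * m * m + m\<^sup>2"
    using L2_sq_integrable[OF assms] L2_integrable[OF assms]
    by (simp add: L2_norm_power2 m_def[symmetric] measure_leb01)
  finally have "m\<^sup>2 \<le> (L2_norm f)\<^sup>2" by (simp add: power2_eq_square)
  then show ?thesis unfolding m_def by (rule power2_le_imp_le) (rule L2_norm_nonneg)
qed

section \<open>Weak derivatives\<close>

text \<open>A primitive is constant on each side of the support, and zero mean makes the two
  constants agree, so both can be normalised to 0. This supplies enough derivatives of test
  functions for \<open>du_Bois_Reymond\<close>.\<close>

lemma test_fun_antiderivative:
  fixes \<zeta> :: "real \<Rightarrow> real"
  assumes c: "continuous_on UNIV \<zeta>" and ab: "0 < a" "b < 1"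
    and z: "\<And>x. x \<notin> {a..b} \<Longrightarrow> \<zeta> x = 0" and i: "(\<zeta> has_integral 0) {0..1}"
  shows "\<exists>\<phi>. test_fun \<phi> \<and> deriv \<phi> = \<zeta>"
proof -
  have "\<exists>F. \<forall>x :: real. -\<infinity> < ereal x \<longrightarrow> ereal x < \<infinity> \<longrightarrow> (F has_vector_derivative \<zeta> x) (at x)"
    using c by (intro einterval_antiderivative) (auto simp: continuous_on_eq_continuous_at)
  then obtain F where F: "\<And>x. (F has_real_derivative \<zeta> x) (at x)"
    by (auto simp: has_real_derivative_iff_has_vector_derivative)
  define \<phi> where "\<phi> x = F x - F 0" for x
  have d: "(\<phi> has_real_derivative \<zeta> x) (at x)" for x
    unfolding \<phi>_def using F by (auto intro!: derivative_eq_intros)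
  have left: "\<phi> x = 0" if "x < a" for x
  proof -
    have "\<And>y. y \<in> {..<a} \<Longrightarrow> (\<phi> has_real_derivative 0) (at y within {..<a})"
    proof -
      fix y assume "y \<in> {..<a}"
      then show "(\<phi> has_real_derivative 0) (at y within {..<a})"
        using has_field_derivative_at_within[OF d[of y]] z[of y] by auto
    qed
    then obtain k where k: "\<And>y. y \<in> {..<a} \<Longrightarrow> \<phi> y = k"
      using has_field_derivative_zero_constant[of "{..<a}" \<phi>] by auto
    from k[of 0] k[of x] that ab show ?thesis by (simp add: \<phi>_def)
  qed
  have "(\<zeta> has_integral (\<phi> 1 - \<phi> 0)) {0..1}"
    using d by (intro fundamental_theorem_of_calculus)
     (auto simp: has_real_derivative_iff_has_vector_derivative intro: has_vector_derivative_at_within)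
  with i have one: "\<phi> 1 = 0" using has_integral_unique[OF i, of "\<phi> 1 - \<phi> 0"] by (simp add: \<phi>_def)
  have right: "\<phi> x = 0" if "x > b" for x
  proof -
    have "\<And>y. y \<in> {b<..} \<Longrightarrow> (\<phi> has_real_derivative 0) (at y within {b<..})"
    proof -
      fix y assume "y \<in> {b<..}"
      then show "(\<phi> has_real_derivative 0) (at y within {b<..})"
        using has_field_derivative_at_within[OF d[of y]] z[of y] by auto
    qed
    then obtain k where k: "\<And>y. y \<in> {b<..} \<Longrightarrow> \<phi> y = k"
      using has_field_derivative_zero_constant[of "{b<..}" \<phi>] by auto
    from k[of 1] k[of x] that ab one show ?thesis by simp
  qed
  have "test_fun \<phi>"
    unfolding test_fun_def
  proof (intro conjI exI)
    show "\<phi> C1_differentiable_on UNIV"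
      unfolding C1_differentiable_on_def using d c
      by (auto simp: has_real_derivative_iff_has_vector_derivative)
    show "compact {a..b}" "{a..b} \<subseteq> {0<..<1}" using ab by auto
    show "\<forall>x. x \<notin> {a..b} \<longrightarrow> \<phi> x = 0" using left right by (auto simp: not_le)
  qed
  moreover have "deriv \<phi> = \<zeta>" using d by (auto intro: DERIV_imp_deriv)
  ultimately show ?thesis by blast
qed

text \<open>A trapezoid is enough to approximate an indicator: it will be used as the derivative of
  a test function, which only has to be continuous.\<close>

definition plateau :: "real \<Rightarrow> real \<Rightarrow> nat \<Rightarrow> real \<Rightarrow> real" where
  "plateau a b n x = max 0 (min 1 (real n * min (x - a) (b - x)))"

lemma plateau_continuous: "continuous_on S (plateau a b n)"
  unfolding plateau_def by (intro continuous_intros)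

lemma plateau_bounds: "0 \<le> plateau a b n x" "plateau a b n x \<le> 1"
  by (auto simp: plateau_def)

lemma plateau_eq_0: "x \<notin> {a<..<b} \<Longrightarrow> plateau a b n x = 0"
proof -
  assume "x \<notin> {a<..<b}"
  then have "real n * min (x - a) (b - x) \<le> 0" by (intro mult_nonneg_nonpos) auto
  then show ?thesis by (simp add: plateau_def)
qed

lemma plateau_tendsto: "(\<lambda>n. plateau a b n x) \<longlonglongrightarrow> indicat_real {a<..<b} x"
proof (cases "x \<in> {a<..<b}")
  case True
  define d where "d = min (x - a) (b - x)"
  have d: "d > 0" using True by (auto simp: d_def)
  obtain m where m: "1 / d < real m" using reals_Archimedean2 by blast
  have "plateau a b n x = 1" if "n \<ge> m" for n
  proof -
    have "1 / d < real n" using m that by linarith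
    then have "1 < real n * d" using d by (simp add: field_simps)
    then show ?thesis by (simp add: plateau_def d_def[symmetric])
  qed
  then have "\<forall>\<^sub>F n in sequentially. plateau a b n x = 1" by (auto simp: eventually_sequentially)
  then show ?thesis using True by (simp add: tendsto_eventually)
qed (simp add: plateau_eq_0)

text \<open>The classical conclusion is that \<open>K\<close> is constant almost everywhere; the
  form with primitives is the one that later integrations consume. A plateau minus a multiple of one
  fixed bump has mean zero, so it is the derivative of a test function. Hence \<open>K\<close> pairs
  with every plateau as a constant c does, and the plateaus converge to indicators.\<close>

lemma du_Bois_Reymond:
  fixes K :: "real \<Rightarrow> real"
  assumes K: "integrable leb01 K"
    and orth: "\<And>\<phi>. test_fun \<phi> \<Longrightarrow> (\<integral>x. K x * deriv \<phi> x \<partial>leb01) = 0"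
  shows "\<exists>c. \<forall>x\<in>{0..1}. integral {0..x} K = c * x"
proof -
  have Kb: "integrable leb01 (\<lambda>x. K x * h x)" if "continuous_on UNIV h" "\<And>x. \<bar>h x\<bar> \<le> C" for h and C :: real
  proof (rule Bochner_Integration.integrable_bound)
    show "integrable leb01 (\<lambda>x. C * K x)" using K by simp
    show "(\<lambda>x. K x * h x) \<in> borel_measurable leb01"
      using borel_measurable_integrable[OF K]
        measurable_leb01_continuous[OF continuous_on_subset[OF that(1) subset_UNIV]]
      by (rule borel_measurable_times)
    have C: "C \<ge> 0" using that(2)[of 0] by linarith
    have "\<bar>K x * h x\<bar> \<le> \<bar>C * K x\<bar>" for x
      using mult_left_mono[OF that(2)[of x], of "\<bar>K x\<bar>"] C by (simp add: abs_mult mult_ac)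
    then show "AE x in leb01. norm (K x * h x) \<le> norm (C * K x)" by auto
  qed
  \<comment> \<open>The fixed bump. Its integral \<open>I\<close> is nonzero, and \<open>c\<close>
    is the only constant that can pair with \<open>e\<close> as \<open>K\<close> does.\<close>
  define e where "e = plateau (1/4) (3/4) 8"
  have ec: "continuous_on S e" for S unfolding e_def by (rule plateau_continuous)
  define I where "I = integral {0..1} e"
  have "I \<noteq> 0"
  proof
    assume "I = 0"
    then have "(e has_integral 0) (cbox 0 1)"
      unfolding I_def using integrable_continuous_real[OF ec, of 0 1] by (simp add: has_integral_iff)
    then have "e (1/2) = 0"
      by (rule has_integral_0_cbox_imp_0[rotated 2]) (use ec in \<open>auto simp: e_def plateau_bounds\<close>)
    then show False by (simp add: e_def plateau_def)
  qed
  define c where "c = (\<integral>x. K x * e x \<partial>leb01) / I"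
  have key: "(\<integral>x. K x * plateau a b n x \<partial>leb01) = c * integral {0..1} (plateau a b n)"
    if ab: "0 < a" "b < 1" for a b n
  proof -
    \<comment> \<open>This multiple of \<open>e\<close> gives \<open>\<zeta>\<close> mean
      zero.\<close>
    define m where "m = integral {0..1} (plateau a b n) / I"
    define \<zeta> where "\<zeta> x = plateau a b n x - m * e x" for x
    have "\<exists>\<phi>. test_fun \<phi> \<and> deriv \<phi> = \<zeta>"
    proof (rule test_fun_antiderivative[of _ "min a (1/4)" "max b (3/4)"])
      show "continuous_on UNIV \<zeta>" unfolding \<zeta>_def by (intro continuous_intros plateau_continuous ec)
      show "\<zeta> x = 0" if "x \<notin> {min a (1/4)..max b (3/4)}" for x
      proof -
        have "x \<notin> {a<..<b}" "x \<notin> {1/4<..<3/4}" using that by auto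
        from this[THEN plateau_eq_0] show ?thesis by (simp add: \<zeta>_def e_def)
      qed
      have "(\<zeta> has_integral (integral {0..1} (plateau a b n) - m * I)) {0..1}"
        unfolding \<zeta>_def I_def
        by (intro has_integral_diff has_integral_mult_right integrable_integral integrable_continuous_real
            plateau_continuous ec)
      then show "(\<zeta> has_integral 0) {0..1}" using \<open>I \<noteq> 0\<close> by (simp add: m_def)
    qed (use ab in auto)
    then obtain \<phi> where "test_fun \<phi>" "deriv \<phi> = \<zeta>" by blast
    then have "(\<integral>x. K x * \<zeta> x \<partial>leb01) = 0" using orth by metis
    moreover have "(\<integral>x. K x * \<zeta> x \<partial>leb01) = (\<integral>x. K x * plateau a b n x - m * (K x * e x) \<partial>leb01)"
      by (simp add: \<zeta>_def algebra_simps)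
    moreover have "\<dots> = (\<integral>x. K x * plateau a b n x \<partial>leb01) - m * (\<integral>x. K x * e x \<partial>leb01)"
      using Kb[OF plateau_continuous, of a b n 1] Kb[OF ec, of 1] plateau_bounds
      by (simp add: e_def)
    ultimately show ?thesis using \<open>I \<noteq> 0\<close> by (simp add: m_def c_def)
  qed
  define P where "P x = integral {0..x} K" for x
  have Kabs: "K absolutely_integrable_on {0..1}" using K by (simp add: integrable_leb01_iff)
  then have Ki: "K integrable_on {0..1}" by (simp add: absolutely_integrable_on_def)
  have ind: "integral\<^sup>L leb01 (\<lambda>x. h x * indicat_real {a<..<b} x) = integral {a..b} h"
    if "0 < a" "a \<le> b" "b < 1" "integrable leb01 h" for a b and h :: "real \<Rightarrow> real"
  proof -
    have "integrable leb01 (\<lambda>x. h x * indicat_real {a<..<b} x)"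
      using that by (intro integrable_real_mult_indicator) (auto simp: sets_restrict_space_iff)
    then have "integral\<^sup>L leb01 (\<lambda>x. h x * indicat_real {a<..<b} x) = integral {0..1} (\<lambda>x. h x * indicat_real {a<..<b} x)"
      by (rule integral_leb01)
    also have "\<dots> = integral {0..1} (\<lambda>x. if x \<in> {a<..<b} then h x else 0)"
      by (rule integral_cong) (auto simp: indicator_def)
    also have "\<dots> = integral {a<..<b} h"
    proof -
      have "{a<..<b} \<inter> {0..1} = {a<..<b}" using that by auto
      then show ?thesis by (metis integral_restrict_Int)
    qed
    finally show ?thesis by (simp add: integral_open_interval_real)
  qed
  have Pab: "P b - P a = c * (b - a)" if ab: "0 < a" "a \<le> b" "b < 1" for a b
  proof -
    have "(\<lambda>n. \<integral>x. K x * plateau a b n x \<partial>leb01) \<longlonglongrightarrow> (\<integral>x. K x * indicat_real {a<..<b} x \<partial>leb01)"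
    proof (rule integral_dominated_convergence[where w = "\<lambda>x. \<bar>K x\<bar>"])
      show "(\<lambda>x. K x * plateau a b n x) \<in> borel_measurable leb01" for n
        using borel_measurable_integrable[OF K] measurable_leb01_continuous[OF plateau_continuous]
        by (rule borel_measurable_times)
      show "(\<lambda>x. K x * indicat_real {a<..<b} x) \<in> borel_measurable leb01"
        using K ab by (intro borel_measurable_integrable integrable_real_mult_indicator) (auto simp: sets_restrict_space_iff)
      show "AE x in leb01. (\<lambda>n. K x * plateau a b n x) \<longlonglongrightarrow> K x * indicat_real {a<..<b} x"
        by (intro AE_I2 tendsto_intros plateau_tendsto)
      show "AE x in leb01. norm (K x * plateau a b n x) \<le> \<bar>K x\<bar>" for n
        using plateau_bounds by (intro AE_I2) (auto simp: abs_mult intro!: mult_left_le)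
    qed (use K in auto)
    moreover have "(\<lambda>n. \<integral>x. plateau a b n x \<partial>leb01) \<longlonglongrightarrow> (\<integral>x. 1 * indicat_real {a<..<b} x \<partial>leb01)"
    proof (rule integral_dominated_convergence[where w = "\<lambda>x. 1"])
      show "plateau a b n \<in> borel_measurable leb01" for n
        by (rule measurable_leb01_continuous[OF plateau_continuous])
      show "(\<lambda>x. 1 * indicat_real {a<..<b} x) \<in> borel_measurable leb01"
        using ab by (intro borel_measurable_integrable integrable_real_mult_indicator)
           (auto simp: sets_restrict_space_iff)
      show "AE x in leb01. (\<lambda>n. plateau a b n x) \<longlonglongrightarrow> 1 * indicat_real {a<..<b} x"
        using plateau_tendsto by auto
      show "AE x in leb01. norm (plateau a b n x) \<le> 1" for n
        using plateau_bounds by (intro AE_I2) auto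
    qed auto
    then have "(\<lambda>n. c * (\<integral>x. plateau a b n x \<partial>leb01)) \<longlonglongrightarrow> c * (b - a)"
      using ab ind[OF ab, of "\<lambda>x. 1"] by (intro tendsto_mult_left) simp
    moreover have "(\<integral>x. K x * plateau a b n x \<partial>leb01) = c * (\<integral>x. plateau a b n x \<partial>leb01)" for n
      using key ab by (simp add: integral_leb01 integrable_leb01_continuous plateau_continuous)
    ultimately have "integral {a..b} K = c * (b - a)"
      using ind[OF ab K] LIMSEQ_unique by force
    moreover have "integral {0..a} K + integral {a..b} K = integral {0..b} K"
      using ab Ki by (intro Henstock_Kurzweil_Integration.integral_combine)
        (auto intro: integrable_on_subinterval)
    ultimately show ?thesis by (simp add: P_def)
  qed
  \<comment> \<open>\<open>Pab\<close> stays away from the end points, because test functions do.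
    Continuity of \<open>P\<close> carries the affine formula to the closed interval, and
    \<open>P 0 = 0\<close> fixes its constant term.\<close>
  have Pc: "continuous_on {0..1} (\<lambda>x. P x - c * x)"
    unfolding P_def by (intro continuous_intros indefinite_integral_continuous_1 Ki)
  have const: "P x - c * x = P (1/2) - c * (1/2)" if "x \<in> {0<..<1}" for x
    using Pab[of x "1/2"] Pab[of "1/2" x] that by (cases "x \<le> 1/2") (auto simp: algebra_simps)
  have "P x - c * x = P (1/2) - c * (1/2)" if "x \<in> {0..1}" for x
    using continuous_constant_on_closure[of "{0<..<1}" "\<lambda>x. P x - c * x" "P (1/2) - c * (1/2)" x]
      Pc const that by simp
  note P1 = this
  have "P x = c * x" if "x \<in> {0..1}" for x
  proof -
    have "P 0 = 0" by (simp add: P_def)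
    then show ?thesis using P1[of 0] P1[OF that] by simp
  qed
  then show ?thesis unfolding P_def by blast
qed

section \<open>Classical regularity recovered from weak derivatives\<close>

lemma test_fun_D:
  assumes "test_fun \<phi>"
  shows "(\<phi> has_real_derivative deriv \<phi> x) (at x)" "continuous_on S (deriv \<phi>)" "\<phi> 0 = 0" "\<phi> 1 = 0"
proof -
  obtain D where D: "\<And>x. (\<phi> has_vector_derivative D x) (at x)" "continuous_on UNIV D"
    using assms unfolding test_fun_def C1_differentiable_on_def by auto
  then have d: "(\<phi> has_real_derivative D x) (at x)" for x
    by (simp add: has_real_derivative_iff_has_vector_derivative)
  then have eq: "deriv \<phi> = D" by (auto intro: DERIV_imp_deriv)
  show "(\<phi> has_real_derivative deriv \<phi> x) (at x)" using d eq by simp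
  show "continuous_on S (deriv \<phi>)" using D(2) eq by (auto intro: continuous_on_subset)
  obtain K where "K \<subseteq> {0<..<1::real}" "\<And>x. x \<notin> K \<Longrightarrow> \<phi> x = 0"
    using assms unfolding test_fun_def by auto
  moreover have "(0::real) \<notin> {0<..<1}" "(1::real) \<notin> {0<..<1}" by auto
  ultimately show "\<phi> 0 = 0" "\<phi> 1 = 0" by blast+
qed

lemma test_fun_continuous: "test_fun \<phi> \<Longrightarrow> continuous_on S \<phi>"
  by (meson DERIV_continuous_on has_field_derivative_at_within test_fun_D(1))

lemma weak_deriv_H1:
  assumes "h \<in> H1"
  shows "weak_deriv h \<in> L2" "has_weak_deriv h (weak_deriv h)"
proof -
  have "\<exists>g. g \<in> L2 \<and> has_weak_deriv h g" using assms by (auto simp: H1_def)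
  from someI_ex[OF this] show "weak_deriv h \<in> L2" "has_weak_deriv h (weak_deriv h)"
    by (auto simp: weak_deriv_def)
qed

lemma has_weak_deriv_diff:
  assumes L2: "h1 \<in> L2" "h2 \<in> L2" "g1 \<in> L2" "g2 \<in> L2"
    and w: "has_weak_deriv h1 g1" "has_weak_deriv h2 g2"
  shows "has_weak_deriv (\<lambda>x. h1 x - h2 x) (\<lambda>x. g1 x - g2 x)"
  unfolding has_weak_deriv_def
proof (intro allI impI)
  fix \<phi> assume t: "test_fun \<phi>"
  have p: "\<phi> \<in> L2" "deriv \<phi> \<in> L2" using test_fun_continuous[OF t] test_fun_D(2)[OF t] by (auto intro: L2_continuous)
  show "(\<integral>x. (h1 x - h2 x) * deriv \<phi> x \<partial>leb01) = - (\<integral>x. (g1 x - g2 x) * \<phi> x \<partial>leb01)"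
    using w[unfolded has_weak_deriv_def, rule_format, OF t]
      L2_product_integrable[OF L2(1) p(2)] L2_product_integrable[OF L2(2) p(2)]
      L2_product_integrable[OF L2(3) p(1)] L2_product_integrable[OF L2(4) p(1)]
    by (simp add: left_diff_distrib)
qed

lemma L2_diff: "f \<in> L2 \<Longrightarrow> g \<in> L2 \<Longrightarrow> (\<lambda>x. f x - g x) \<in> L2"
  using L2_lincomb[of f g 1 "-1"] by simp

lemma H1_diff:
  assumes "h1 \<in> H1" "h2 \<in> H1"
  shows "(\<lambda>x. h1 x - h2 x) \<in> H1"
  using assms has_weak_deriv_diff L2_diff unfolding H1_def by blast

lemma L2_has_integral:
  assumes "g \<in> L2" "x \<in> {0..1}"
  shows "(g has_integral integral {0..x} g) {0..x}"
proof -
  have "g integrable_on {0..1}"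
    using L2_integrable[OF assms(1)] by (simp add: integrable_leb01_iff absolutely_integrable_on_def)
  then show ?thesis using assms(2) by (intro integrable_integral) (auto intro: integrable_on_subinterval)
qed

lemma L2_indefinite_continuous: "g \<in> L2 \<Longrightarrow> continuous_on {0..1} (\<lambda>x. integral {0..x} g)"
  using L2_has_integral[of g 1] by (intro indefinite_integral_continuous_1) (auto simp: has_integral_iff)

text \<open>Integration by parts shows that the primitive \<open>G\<close> of \<open>g\<close> also
  has weak derivative \<open>g\<close>. Hence \<open>h - G\<close> annihilates all derivatives of
  test functions, and \<open>du_Bois_Reymond\<close> applies. The identity h = c + G is left in
  integrated form because \<open>h\<close> need not agree with its continuous representative at
  every point.\<close>

lemma weak_deriv_primitive:
  assumes h: "h \<in> L2" and g: "g \<in> L2" and w: "has_weak_deriv h g"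
  shows "\<exists>c. \<forall>x\<in>{0..1}. (h has_integral (c * x + integral {0..x} (\<lambda>y. integral {0..y} g))) {0..x}"
proof -
  define G where "G x = integral {0..x} g" for x
  have Gc: "continuous_on {0..1} G" unfolding G_def using g by (rule L2_indefinite_continuous)
  have GL: "G \<in> L2" using Gc by (rule L2_continuous)
  have "\<exists>c. \<forall>x\<in>{0..1}. integral {0..x} (\<lambda>x. h x - G x) = c * x"
  proof (rule du_Bois_Reymond)
    show "integrable leb01 (\<lambda>x. h x - G x)" using h GL by (intro L2_integrable L2_diff)
    fix \<phi> assume t: "test_fun \<phi>"
    have p: "\<phi> \<in> L2" "deriv \<phi> \<in> L2" using test_fun_continuous[OF t] test_fun_D(2)[OF t] by (auto intro: L2_continuous)
    have "((\<lambda>x. g x * \<phi> x) has_integral (G 1 * \<phi> 1 - G 0 * \<phi> 0 - integral {0..1} (\<lambda>x. G x * deriv \<phi> x))) {0..1}"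
      using L2_integrable[OF g] L2_has_integral[OF g] test_fun_D[OF t]
      by (intro has_integral_by_parts_indefinite)
        (auto simp: integrable_leb01_iff G_def intro: has_field_derivative_at_within)
    then have "integral {0..1} (\<lambda>x. g x * \<phi> x) = - integral {0..1} (\<lambda>x. G x * deriv \<phi> x)"
      using test_fun_D[OF t] by (simp add: integral_unique)
    then have "(\<integral>x. g x * \<phi> x \<partial>leb01) = - (\<integral>x. G x * deriv \<phi> x \<partial>leb01)"
      using L2_product_integrable[OF g p(1)] L2_product_integrable[OF GL p(2)] by (simp add: integral_leb01)
    then show "(\<integral>x. (h x - G x) * deriv \<phi> x \<partial>leb01) = 0"
      using w t L2_product_integrable[OF h p(2)] L2_product_integrable[OF GL p(2)]
      by (simp add: left_diff_distrib has_weak_deriv_def)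
  qed
  then obtain c where c: "\<And>x. x \<in> {0..1} \<Longrightarrow> integral {0..x} (\<lambda>x. h x - G x) = c * x" by blast
  have "(h has_integral (c * x + integral {0..x} G)) {0..x}" if x: "x \<in> {0..1}" for x
  proof -
    have "((\<lambda>x. (h x - G x) + G x) has_integral (integral {0..x} (\<lambda>x. h x - G x) + integral {0..x} G)) {0..x}"
      using x h GL by (intro has_integral_add L2_has_integral L2_diff)
    then show ?thesis using c[OF x] by simp
  qed
  then show ?thesis unfolding G_def by blast
qed

lemma has_real_derivative_indefinite:
  fixes f :: "real \<Rightarrow> real"
  assumes "continuous_on {0..1} f" "x \<in> {0..1}"
  shows "((\<lambda>x. integral {0..x} f) has_real_derivative f x) (at x within {0..1})"
  using integral_has_vector_derivative[OF assms] by (simp add: has_real_derivative_iff_has_vector_derivative)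

lemma has_real_derivative_unique_01:
  fixes h :: "real \<Rightarrow> real"
  assumes "(h has_real_derivative a) (at x within {0..1})" "(h has_real_derivative b) (at x within {0..1})"
    "x \<in> {0..1}"
  shows "a = b"
  using vector_derivative_unique_within_closed_interval[of 0 1 x h a b] assms
  by (auto simp: has_real_derivative_iff_has_vector_derivative)

text \<open>When \<open>h\<close> is continuous, the integrated identity can be differentiated at
  every point of \<open>{0..1}\<close>, which gives h = c + G everywhere.\<close>

lemma continuous_weak_deriv:
  assumes h: "continuous_on {0..1} h" and g: "g \<in> L2" and w: "has_weak_deriv h g" and x: "x \<in> {0..1}"
  shows "(g has_integral (h x - h 0)) {0..x}"
proof -
  define G where "G x = integral {0..x} g" for x
  have Gc: "continuous_on {0..1} G" unfolding G_def using g by (rule L2_indefinite_continuous)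
  obtain c where c: "\<And>x. x \<in> {0..1} \<Longrightarrow> (h has_integral (c * x + integral {0..x} G)) {0..x}"
    using weak_deriv_primitive[OF L2_continuous[OF h] g w] unfolding G_def by blast
  have hc: "h y = c + G y" if y: "y \<in> {0..1}" for y
  proof (rule has_real_derivative_unique_01[OF _ _ y])
    have "((\<lambda>x. c * x + integral {0..x} G) has_real_derivative (c + G y)) (at y within {0..1})"
      by (auto intro!: derivative_eq_intros has_real_derivative_indefinite Gc y)
    then show "((\<lambda>x. integral {0..x} h) has_real_derivative (c + G y)) (at y within {0..1})"
      using y by (rule has_field_derivative_transform_within[OF _ zero_less_one])
        (use c in \<open>auto intro!: integral_unique[symmetric]\<close>)
    show "((\<lambda>x. integral {0..x} h) has_real_derivative h y) (at y within {0..1})"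
      using has_real_derivative_indefinite[OF h y] .
  qed
  have "G 0 = 0" by (simp add: G_def)
  then have "h x - h 0 = G x" using hc[OF x] hc[of 0] by simp
  then show ?thesis using L2_has_integral[OF g x] by (simp add: G_def)
qed

text \<open>The pair \<open>(h', g)\<close> consists of the classical first derivative and an \<open>L2\<close> representative of the
  second derivative of \<open>h\<close>.\<close>

definition H2_derivs :: "(real \<Rightarrow> real) \<Rightarrow> (real \<Rightarrow> real) \<Rightarrow> (real \<Rightarrow> real) \<Rightarrow> bool" where
  "H2_derivs h h' g \<longleftrightarrow> g \<in> L2 \<and> (\<forall>x\<in>{0..1}. (h has_real_derivative h' x) (at x within {0..1}) \<and>
     (g has_integral (h' x - h' 0)) {0..x})"

text \<open>\<open>weak_deriv h\<close> is an arbitrary representative, so it cannot serve as the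
  classical derivative. Its integral can be computed twice: as the increment of \<open>h\<close>,
  and, through its own weak derivative, as the integral of the continuous function
  \<open>c + G\<close>. Comparing the two shows that \<open>h\<close> is C1 with derivative
  \<open>c + G\<close>.\<close>

lemma H2_imp_H2_derivs:
  assumes "h \<in> H2" "continuous_on {0..1} h"
  shows "\<exists>h'. H2_derivs h h' (weak_deriv (weak_deriv h))"
proof -
  define h1 where "h1 = weak_deriv h"
  define g where "g = weak_deriv h1"
  have H: "h \<in> H1" "h1 \<in> H1" using assms by (auto simp: H2_def h1_def)
  have w: "h1 \<in> L2" "has_weak_deriv h h1" "g \<in> L2" "has_weak_deriv h1 g"
    using H weak_deriv_H1 unfolding h1_def g_def by auto
  define G where "G x = integral {0..x} g" for x
  have Gc: "continuous_on {0..1} G" unfolding G_def using w(3) by (rule L2_indefinite_continuous)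
  obtain c where c: "\<And>x. x \<in> {0..1} \<Longrightarrow> (h1 has_integral (c * x + integral {0..x} G)) {0..x}"
    using weak_deriv_primitive[OF w(1,3,4)] unfolding G_def by blast
  have eq: "h x = h 0 + (c * x + integral {0..x} G)" if "x \<in> {0..1}" for x
    using has_integral_unique[OF c continuous_weak_deriv[OF assms(2) w(1,2)]] that by force
  have "(h has_real_derivative (c + G y)) (at y within {0..1})" if y: "y \<in> {0..1}" for y
  proof -
    have "((\<lambda>x. h 0 + (c * x + integral {0..x} G)) has_real_derivative (c + G y)) (at y within {0..1})"
      by (auto intro!: derivative_eq_intros has_real_derivative_indefinite Gc y)
    then show ?thesis
      using y by (rule has_field_derivative_transform_within[OF _ zero_less_one])
        (blast intro: eq[symmetric])
  qed
  moreover have "(g has_integral (c + G x - (c + G 0))) {0..x}" if "x \<in> {0..1}" for x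
    using L2_has_integral[OF w(3) that] by (simp add: G_def)
  ultimately have "H2_derivs h (\<lambda>x. c + G x) g" using w(3) unfolding H2_derivs_def by blast
  then show ?thesis unfolding g_def h1_def by blast
qed

lemma H2_derivs_continuous:
  assumes "H2_derivs h h' g"
  shows "continuous_on {0..1} h" "continuous_on {0..1} h'"
proof -
  show "continuous_on {0..1} h"
    using assms unfolding H2_derivs_def by (intro DERIV_continuous_on) blast
  have "continuous_on {0..1} (\<lambda>x. h' 0 + integral {0..x} g)"
    using assms unfolding H2_derivs_def by (intro continuous_intros L2_indefinite_continuous) blast
  moreover have "h' 0 + integral {0..x} g = h' x" if "x \<in> {0..1}" for x
    using assms that unfolding H2_derivs_def by (auto dest!: bspec simp: integral_unique)
  ultimately show "continuous_on {0..1} h'" by (metis (no_types, lifting) continuous_on_cong)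
qed

lemma H2_derivs_dx:
  assumes "H2_derivs h h' g" "x \<in> {0..1}"
  shows "dx h x = h' x"
  unfolding dx_def using assms vector_derivative_within_cbox[of 0 1 x h "h' x"]
  by (auto simp: H2_derivs_def has_real_derivative_iff_has_vector_derivative)

lemma H2_derivs_lincomb:
  assumes "H2_derivs h1 h1' g1" "H2_derivs h2 h2' g2"
  shows "H2_derivs (\<lambda>x. a * h1 x + b * h2 x) (\<lambda>x. a * h1' x + b * h2' x) (\<lambda>x. a * g1 x + b * g2 x)"
  unfolding H2_derivs_def
proof (intro conjI ballI)
  show "(\<lambda>x. a * g1 x + b * g2 x) \<in> L2" using assms by (auto simp: H2_derivs_def intro: L2_lincomb)
  fix x :: real assume x: "x \<in> {0..1}"
  have d: "(h1 has_real_derivative h1' x) (at x within {0..1})" "(h2 has_real_derivative h2' x) (at x within {0..1})"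
    and i: "(g1 has_integral (h1' x - h1' 0)) {0..x}" "(g2 has_integral (h2' x - h2' 0)) {0..x}"
    using assms x by (auto simp: H2_derivs_def)
  show "((\<lambda>x. a * h1 x + b * h2 x) has_real_derivative a * h1' x + b * h2' x) (at x within {0..1})"
    using d by (auto intro!: derivative_eq_intros)
  have "((\<lambda>x. a * g1 x + b * g2 x) has_integral (a * (h1' x - h1' 0) + b * (h2' x - h2' 0))) {0..x}"
    using i by (intro has_integral_add has_integral_mult_right)
  then show "((\<lambda>x. a * g1 x + b * g2 x) has_integral (a * h1' x + b * h2' x - (a * h1' 0 + b * h2' 0))) {0..x}"
    by (simp add: algebra_simps)
qed

text \<open>The one-dimensional Sobolev embedding: the oscillation of \<open>h\<close> is at most
  the L2 norm of the weak derivative, so averaging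
  \<open>\<bar>h x\<bar> - L2_norm g \<le> \<bar>h y\<bar>\<close> over y bounds the value at
  x.\<close>

lemma H1_sup_le:
  assumes h: "h \<in> H1" "continuous_on {0..1} h" and x: "x \<in> {0..1}"
  shows "\<bar>h x\<bar> \<le> L2_norm h + L2_norm (weak_deriv h)"
proof -
  define g where "g = weak_deriv h"
  have g: "g \<in> L2" "has_weak_deriv h g" using weak_deriv_H1[OF h(1)] by (auto simp: g_def)
  have gi: "integrable leb01 (\<lambda>x. \<bar>g x\<bar>)" using L2_integrable[OF g(1)] by simp
  have ga: "(\<lambda>x. \<bar>g x\<bar>) integrable_on {0..1}" 
    using gi by (simp add: integrable_leb01_iff absolutely_integrable_on_def)
  have gn: "integral {0..1} (\<lambda>x. \<bar>g x\<bar>) \<le> L2_norm g"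
    using integral_abs_le_L2_norm[OF g(1)] gi by (simp add: integral_leb01)
  have osc: "\<bar>h b - h a\<bar> \<le> L2_norm g" if "0 \<le> a" "a \<le> b" "b \<le> 1" for a b
  proof -
    have "(g has_integral (h b - h a)) {a..b}"
      by (rule indefinite_integral_diff[of 0 1, OF continuous_weak_deriv[OF h(2) g]]) (use that in auto)
    then have "\<bar>h b - h a\<bar> \<le> integral {a..b} (\<lambda>x. \<bar>g x\<bar>)"
      using integral_norm_bound_integral[of g "{a..b}" "\<lambda>x. \<bar>g x\<bar>"]
        integrable_on_subinterval[OF ga, of a b] that
      by (auto simp: has_integral_iff)
    also have "\<dots> \<le> integral {0..1} (\<lambda>x. \<bar>g x\<bar>)"
      using integrable_on_subinterval[OF ga, of a b] ga that by (intro integral_subset_le) auto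
    finally show ?thesis using gn by simp
  qed
  have osc': "\<bar>h x\<bar> - L2_norm g \<le> \<bar>h y\<bar>" if "y \<in> {0..1}" for y
    using osc[of x y] osc[of y x] that x by (cases "x \<le> y") auto
  have "\<bar>h x\<bar> - L2_norm g = (\<integral>y. (\<bar>h x\<bar> - L2_norm g) \<partial>leb01)" by (simp only: integral_leb01_const)
  also have "\<dots> \<le> (\<integral>y. \<bar>h y\<bar> \<partial>leb01)"
    using L2_integrable[OF L2_continuous[OF h(2)]] osc'
    by (intro integral_mono) (auto simp: space_restrict_space)
  also have "\<dots> \<le> L2_norm h" by (rule integral_abs_le_L2_norm[OF L2_continuous[OF h(2)]])
  finally show ?thesis by (simp add: g_def)
qed

section \<open>Strong solutions\<close>

text \<open>Convergence in H2 controls point values by \<open>H1_sup_le\<close>, end points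
  included. The cyclic argument needs this to know that the weighted suprema of the traces at x = 1
  are finite.\<close>

lemma sol_continuous_in_time:
  assumes r: "regular u" and x: "x \<in> {0..1}"
  shows "continuous_on {0..} (\<lambda>t. u x t)"
  unfolding continuous_on_def
proof
  fix t :: real assume t: "t \<in> {0..}"
  have H2: "(\<lambda>x. u x s) \<in> H1" "continuous_on {0..1} (\<lambda>x. u x s)" if "s \<ge> 0" for s
    using r that by (auto simp: regular_def C_H2_def H2_def)
  have lim: "((\<lambda>s. H2_norm (\<lambda>x. u x s - u x t)) \<longlongrightarrow> 0) (at t within {0..})"
    using r t by (auto simp: regular_def C_H2_def)
  have "((\<lambda>s. u x s - u x t) \<longlongrightarrow> 0) (at t within {0..})"
  proof (rule Lim_null_comparison)
    show "\<forall>\<^sub>F s in at t within {0..}. norm (u x s - u x t) \<le> 2 * H2_norm (\<lambda>x. u x s - u x t)"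
      unfolding eventually_at_filter
    proof (intro always_eventually allI impI)
      fix s :: real assume "s \<in> {0..}"
      define h where "h = (\<lambda>x. u x s - u x t)"
      have h: "h \<in> H1" "continuous_on {0..1} h"
        unfolding h_def using H2 \<open>s \<in> {0..}\<close> t by (auto intro!: H1_diff continuous_on_diff)
      have "\<bar>h x\<bar> \<le> L2_norm h + L2_norm (weak_deriv h)" using H1_sup_le[OF h x] .
      moreover have "L2_norm h \<le> H2_norm h" "L2_norm (weak_deriv h) \<le> H2_norm h"
        unfolding H2_norm_def by (auto intro!: real_le_rsqrt)
      ultimately show "norm (u x s - u x t) \<le> 2 * H2_norm (\<lambda>x. u x s - u x t)"
        unfolding h_def by simp
    qed
    show "((\<lambda>s. 2 * H2_norm (\<lambda>x. u x s - u x t)) \<longlongrightarrow> 0) (at t within {0..})"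
      using tendsto_mult_left[OF lim, of 2] by simp
  qed
  then show "((\<lambda>t. u x t) \<longlongrightarrow> u x t) (at t within {0..})" by (simp add: LIM_zero_iff)
qed

text \<open>\<open>weak_deriv\<close> and \<open>time_deriv\<close> are arbitrary choices and hence
  linear only up to null sets. Quantifying over representatives gives a class that is closed under
  linear combinations, while the first derivative is fixed as \<open>dx\<close> so that boundary
  conditions can be read off. Time differentiability includes t = 0, where the energy must be
  continuous.\<close>

definition strong_solution ::
    "real \<Rightarrow> real \<Rightarrow> (real \<Rightarrow> real \<Rightarrow> real) \<Rightarrow> (real \<Rightarrow> real \<Rightarrow> real) \<Rightarrow> bool" where
  "strong_solution \<alpha> lam f u \<longleftrightarrow>
     (\<forall>t\<ge>0. \<exists>g w. H2_derivs (\<lambda>x. u x t) (dx (\<lambda>x. u x t)) g \<and> has_L2_time_deriv u w t \<and>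
        (t > 0 \<longrightarrow> (AE x in leb01. w x = \<alpha> * g x - lam * u x t + f x t))) \<and>
     (\<forall>x\<in>{0..1}. continuous_on {0..} (u x))"

lemma H2_derivs_dxI:
  assumes "H2_derivs h h' g"
  shows "H2_derivs h (dx h) g"
proof -
  have e: "dx h x = h' x" if "x \<in> {0..1}" for x using H2_derivs_dx[OF assms that] .
  have e0: "dx h 0 = h' 0" by (rule e) simp
  show ?thesis using assms unfolding H2_derivs_def by (simp add: e e0)
qed

lemma strong_solutionI:
  assumes r: "regular u" and p: "solves_pde \<alpha> lam f u"
  shows "strong_solution \<alpha> lam f u"
  unfolding strong_solution_def
proof (intro conjI allI impI ballI)
  fix t :: real assume t: "0 \<le> t"
  have "(\<lambda>x. u x t) \<in> H2" "continuous_on {0..1} (\<lambda>x. u x t)"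
    using r t by (auto simp: regular_def C_H2_def)
  then obtain h' where "H2_derivs (\<lambda>x. u x t) h' (weak_deriv (weak_deriv (\<lambda>x. u x t)))"
    using H2_imp_H2_derivs by blast
  then have "H2_derivs (\<lambda>x. u x t) (dx (\<lambda>x. u x t)) (weak_deriv (weak_deriv (\<lambda>x. u x t)))"
    by (rule H2_derivs_dxI)
  moreover have "has_L2_time_deriv u (\<lambda>x. time_deriv u x t) t"
  proof -
    have "\<exists>w. has_L2_time_deriv u w t" using r t by (auto simp: regular_def C1_L2_def)
    from someI_ex[OF this] show ?thesis by (simp add: time_deriv_def)
  qed
  moreover have "AE x in leb01. time_deriv u x t =
      \<alpha> * weak_deriv (weak_deriv (\<lambda>x. u x t)) x - lam * u x t + f x t" if "t > 0"
    using p that by (auto simp: solves_pde_def)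
  ultimately show "\<exists>g w. H2_derivs (\<lambda>x. u x t) (dx (\<lambda>x. u x t)) g \<and> has_L2_time_deriv u w t \<and>
        (t > 0 \<longrightarrow> (AE x in leb01. w x = \<alpha> * g x - lam * u x t + f x t))" by blast
next
  fix x :: real assume "x \<in> {0..1}"
  then show "continuous_on {0..} (u x)" using sol_continuous_in_time[OF r] by simp
qed

lemma strong_solution_continuous:
  assumes "strong_solution \<alpha> lam f u" "t \<ge> 0"
  shows "continuous_on {0..1} (\<lambda>x. u x t)"
  using assms H2_derivs_continuous(1) unfolding strong_solution_def by blast

lemma has_L2_time_deriv_lincomb:
  assumes u: "has_L2_time_deriv u1 w1 t" "has_L2_time_deriv u2 w2 t"
    and L2: "\<And>s. s \<ge> 0 \<Longrightarrow> (\<lambda>x. u1 x s) \<in> L2" "\<And>s. s \<ge> 0 \<Longrightarrow> (\<lambda>x. u2 x s) \<in> L2" and t: "t \<ge> 0"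
  shows "has_L2_time_deriv (\<lambda>x t. a * u1 x t + b * u2 x t) (\<lambda>x. a * w1 x + b * w2 x) t"
  unfolding has_L2_time_deriv_def
proof
  have w: "w1 \<in> L2" "w2 \<in> L2" using u by (auto simp: has_L2_time_deriv_def)
  then show "(\<lambda>x. a * w1 x + b * w2 x) \<in> L2" by (rule L2_lincomb)
  define n1 where "n1 s = L2_norm (\<lambda>x. (u1 x s - u1 x t) / (s - t) - w1 x)" for s
  define n2 where "n2 s = L2_norm (\<lambda>x. (u2 x s - u2 x t) / (s - t) - w2 x)" for s
  have e: "(\<lambda>x. (v x s - v x t) / (s - t) - w x) \<in> L2"
    if "\<And>s. s \<ge> 0 \<Longrightarrow> (\<lambda>x. v x s) \<in> L2" "s \<ge> 0" "w \<in> L2" for v :: "real \<Rightarrow> real \<Rightarrow> real" and w s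
    using L2_lincomb[OF L2_diff[OF that(1)[OF that(2)] that(1)[OF t]] that(3), of "1 / (s - t)" "-1"]
    by simp
  have lim: "(n1 \<longlongrightarrow> 0) (at t within {0..})" "(n2 \<longlongrightarrow> 0) (at t within {0..})"
    using u by (simp_all add: has_L2_time_deriv_def n1_def[abs_def] n2_def[abs_def])
  show "((\<lambda>s. L2_norm (\<lambda>x. (a * u1 x s + b * u2 x s - (a * u1 x t + b * u2 x t)) / (s - t)
      - (a * w1 x + b * w2 x))) \<longlongrightarrow> 0) (at t within {0..})"
  proof (rule Lim_null_comparison)
    show "\<forall>\<^sub>F s in at t within {0..}. norm (L2_norm (\<lambda>x. (a * u1 x s + b * u2 x s - (a * u1 x t + b * u2 x t)) / (s - t)
      - (a * w1 x + b * w2 x))) \<le> sqrt (2 * a\<^sup>2 * (n1 s)\<^sup>2 + 2 * b\<^sup>2 * (n2 s)\<^sup>2)"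
      unfolding eventually_at_filter
    proof (intro always_eventually allI impI)
      fix s :: real assume s: "s \<in> {0..}"
      have eq: "(\<lambda>x. (a * u1 x s + b * u2 x s - (a * u1 x t + b * u2 x t)) / (s - t) - (a * w1 x + b * w2 x)) =
        (\<lambda>x. a * ((u1 x s - u1 x t) / (s - t) - w1 x) + b * ((u2 x s - u2 x t) / (s - t) - w2 x))"
        by (simp add: divide_inverse algebra_simps)
      show "norm (L2_norm (\<lambda>x. (a * u1 x s + b * u2 x s - (a * u1 x t + b * u2 x t)) / (s - t)
      - (a * w1 x + b * w2 x))) \<le> sqrt (2 * a\<^sup>2 * (n1 s)\<^sup>2 + 2 * b\<^sup>2 * (n2 s)\<^sup>2)"
        unfolding eq n1_def n2_def using s
        L2_norm_lincomb_le[where a = a and b = b, OF e[where s = s, OF L2(1) _ w(1)] e[where s = s, OF L2(2) _ w(2)]]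
        by (simp add: L2_norm_nonneg)
    qed
    have "((\<lambda>s. sqrt (2 * a\<^sup>2 * (n1 s)\<^sup>2 + 2 * b\<^sup>2 * (n2 s)\<^sup>2)) \<longlongrightarrow> sqrt (2 * a\<^sup>2 * 0\<^sup>2 + 2 * b\<^sup>2 * 0\<^sup>2)) (at t within {0..})"
      by (intro tendsto_intros lim)
    then show "((\<lambda>s. sqrt (2 * a\<^sup>2 * (n1 s)\<^sup>2 + 2 * b\<^sup>2 * (n2 s)\<^sup>2)) \<longlongrightarrow> 0) (at t within {0..})" by simp
  qed
qed

lemma strong_solution_H2_derivs:
  assumes "strong_solution \<alpha> lam f u" "t \<ge> 0"
  obtains g where "H2_derivs (\<lambda>x. u x t) (dx (\<lambda>x. u x t)) g"
  using assms unfolding strong_solution_def by blast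

lemma dx_lincomb:
  assumes "strong_solution \<alpha> lam f1 u1" "strong_solution \<alpha> lam f2 u2" "t \<ge> 0" "x \<in> {0..1}"
  shows "dx (\<lambda>x. a * u1 x t + b * u2 x t) x = a * dx (\<lambda>x. u1 x t) x + b * dx (\<lambda>x. u2 x t) x"
proof -
  obtain g1 where g1: "H2_derivs (\<lambda>x. u1 x t) (dx (\<lambda>x. u1 x t)) g1"
    using assms by (auto elim: strong_solution_H2_derivs)
  obtain g2 where g2: "H2_derivs (\<lambda>x. u2 x t) (dx (\<lambda>x. u2 x t)) g2"
    using assms by (auto elim: strong_solution_H2_derivs)
  show ?thesis using H2_derivs_dx[OF H2_derivs_lincomb[OF g1 g2]] assms by simp
qed

lemma strong_solution_lincomb:
  assumes s1: "strong_solution \<alpha> lam f1 u1" and s2: "strong_solution \<alpha> lam f2 u2"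
  shows "strong_solution \<alpha> lam (\<lambda>x t. a * f1 x t + b * f2 x t) (\<lambda>x t. a * u1 x t + b * u2 x t)"
  unfolding strong_solution_def
proof (intro conjI allI impI ballI)
  fix t :: real assume t: "0 \<le> t"
  obtain g1 w1 where 1: "H2_derivs (\<lambda>x. u1 x t) (dx (\<lambda>x. u1 x t)) g1" "has_L2_time_deriv u1 w1 t"
    "t > 0 \<Longrightarrow> AE x in leb01. w1 x = \<alpha> * g1 x - lam * u1 x t + f1 x t"
    using s1 t unfolding strong_solution_def by blast
  obtain g2 w2 where 2: "H2_derivs (\<lambda>x. u2 x t) (dx (\<lambda>x. u2 x t)) g2" "has_L2_time_deriv u2 w2 t"
    "t > 0 \<Longrightarrow> AE x in leb01. w2 x = \<alpha> * g2 x - lam * u2 x t + f2 x t"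
    using s2 t unfolding strong_solution_def by blast
  have "H2_derivs (\<lambda>x. a * u1 x t + b * u2 x t) (dx (\<lambda>x. a * u1 x t + b * u2 x t)) (\<lambda>x. a * g1 x + b * g2 x)"
    by (rule H2_derivs_dxI[OF H2_derivs_lincomb[OF 1(1) 2(1)]])
  moreover have "has_L2_time_deriv (\<lambda>x t. a * u1 x t + b * u2 x t) (\<lambda>x. a * w1 x + b * w2 x) t"
    using 1(2) 2(2) strong_solution_continuous[OF s1] strong_solution_continuous[OF s2] t
    by (intro has_L2_time_deriv_lincomb L2_continuous)
  moreover have "AE x in leb01. a * w1 x + b * w2 x =
      \<alpha> * (a * g1 x + b * g2 x) - lam * (a * u1 x t + b * u2 x t) + (a * f1 x t + b * f2 x t)" if "t > 0"
    using 1(3)[OF that] 2(3)[OF that]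
  proof eventually_elim
    case (elim x)
    show ?case unfolding elim by (simp add: algebra_simps)
  qed
  ultimately show "\<exists>g w. H2_derivs (\<lambda>x. a * u1 x t + b * u2 x t) (dx (\<lambda>x. a * u1 x t + b * u2 x t)) g \<and>
     has_L2_time_deriv (\<lambda>x t. a * u1 x t + b * u2 x t) w t \<and>
        (t > 0 \<longrightarrow> (AE x in leb01. w x = \<alpha> * g x - lam * (a * u1 x t + b * u2 x t) + (a * f1 x t + b * f2 x t)))"
    by blast
next
  fix x :: real assume "x \<in> {0..1}"
  then show "continuous_on {0..} (\<lambda>t. a * u1 x t + b * u2 x t)"
    using s1 s2 unfolding strong_solution_def by (intro continuous_intros) auto
qed

lemma H2_derivs_const: "H2_derivs (\<lambda>x. c) (\<lambda>x. 0) (\<lambda>x. 0)"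
  unfolding H2_derivs_def by (auto intro: L2_continuous)

lemma dx_const: "x \<in> {0..1} \<Longrightarrow> dx (\<lambda>x. c) x = 0"
  by (rule H2_derivs_dx[OF H2_derivs_const])

lemma L2_norm_const: "L2_norm (\<lambda>x. c) = \<bar>c\<bar>"
  unfolding L2_norm_def by (simp add: measure_leb01)

text \<open>The barrier. Damping at rate \<open>lam\<close> exceeds its decay rate \<sigma>, and the
  surplus appears as a source that can dominate \<open>f\<close>.\<close>

lemma strong_solution_exp:
  "strong_solution \<alpha> lam (\<lambda>x t. (lam - \<sigma>) * (K * exp (- \<sigma> * t))) (\<lambda>x t. K * exp (- \<sigma> * t))"
  unfolding strong_solution_def
proof (intro conjI allI impI ballI)
  fix t :: real assume t: "0 \<le> t"
  have d: "((\<lambda>t. K * exp (- \<sigma> * t)) has_real_derivative (- \<sigma> * (K * exp (- \<sigma> * t)))) (at t within {0..})"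
    by (auto intro!: derivative_eq_intros)
  have "((\<lambda>s. L2_norm (\<lambda>x. (K * exp (- \<sigma> * s) - K * exp (- \<sigma> * t)) / (s - t) - (- \<sigma> * (K * exp (- \<sigma> * t))))) \<longlongrightarrow> 0) (at t within {0..})"
    using d unfolding has_field_derivative_iff L2_norm_const
    by (intro tendsto_rabs_zero) (simp only: LIM_zero_iff)
  then have "has_L2_time_deriv (\<lambda>x t. K * exp (- \<sigma> * t)) (\<lambda>x. - \<sigma> * (K * exp (- \<sigma> * t))) t"
    unfolding has_L2_time_deriv_def by (auto intro: L2_continuous)
  moreover have "AE x in leb01. - \<sigma> * (K * exp (- \<sigma> * t)) =
       \<alpha> * 0 - lam * (K * exp (- \<sigma> * t)) + (lam - \<sigma>) * (K * exp (- \<sigma> * t))"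
    by (intro AE_I2) (simp add: algebra_simps)
  ultimately show "\<exists>g w. H2_derivs (\<lambda>x. K * exp (- \<sigma> * t)) (dx (\<lambda>x. K * exp (- \<sigma> * t))) g \<and>
     has_L2_time_deriv (\<lambda>x t. K * exp (- \<sigma> * t)) w t \<and>
        (t > 0 \<longrightarrow> (AE x in leb01. w x = \<alpha> * g x - lam * (K * exp (- \<sigma> * t)) + (lam - \<sigma>) * (K * exp (- \<sigma> * t))))"
    using H2_derivs_dxI[OF H2_derivs_const] by blast
qed (intro continuous_intros)

lemma strong_solution_diff:
  assumes "strong_solution \<alpha> lam f1 u1" "strong_solution \<alpha> lam f2 u2"
  shows "strong_solution \<alpha> lam (\<lambda>x t. f1 x t - f2 x t) (\<lambda>x t. u1 x t - u2 x t)"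
  using strong_solution_lincomb[OF assms, of 1 "-1"] by simp

lemma dx_diff:
  assumes "strong_solution \<alpha> lam f1 u1" "strong_solution \<alpha> lam f2 u2" "t \<ge> 0" "x \<in> {0..1}"
  shows "dx (\<lambda>x. u1 x t - u2 x t) x = dx (\<lambda>x. u1 x t) x - dx (\<lambda>x. u2 x t) x"
  using dx_lincomb[OF assms, of 1 "-1"] by simp

section \<open>The decay estimate\<close>

text \<open>Used twice, to pass from \<open>\<rho>\<close> to \<open>\<psi>\<close> and from
  \<open>\<psi>\<close> to \<open>\<phi>\<close>. Strict positivity to the right of 0 survives
  integration, and at the end it lets \<open>\<phi> (z x t) = 0\<close> force
  \<open>z x t \<le> 0\<close>.\<close>

lemma positive_antiderivative:
  fixes f :: "real \<Rightarrow> real"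
  assumes c: "continuous_on UNIV f" and f: "\<And>s. s \<le> 0 \<Longrightarrow> f s = 0" "\<And>s. s > 0 \<Longrightarrow> f s > 0"
  obtains F where "\<And>s. (F has_real_derivative f s) (at s)"
    "\<And>s. s \<le> 0 \<Longrightarrow> F s = 0" "\<And>s. s > 0 \<Longrightarrow> F s > 0"
proof -
  have "\<exists>F. \<forall>x :: real. -\<infinity> < ereal x \<longrightarrow> ereal x < \<infinity> \<longrightarrow> (F has_vector_derivative f x) (at x)"
    using c by (intro einterval_antiderivative) (auto simp: continuous_on_eq_continuous_at)
  then obtain F0 where F0: "\<And>x. (F0 has_real_derivative f x) (at x)"
    by (auto simp: has_real_derivative_iff_has_vector_derivative)
  define F where "F x = F0 x - F0 0" for x
  have d: "(F has_real_derivative f x) (at x)" for x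
    unfolding F_def using F0 by (auto intro!: derivative_eq_intros)
  have F_0: "F 0 = 0" by (simp add: F_def)
  show ?thesis
  proof (rule that[OF d])
    fix s :: real
    show "F s = 0" if "s \<le> 0"
    proof (cases "s = 0")
      case False
      then have "s < 0" using that by simp
      then obtain z where "s < z" "z < 0" "F 0 - F s = (0 - s) * f z"
        using MVT2[of s 0 F f] d by auto
      then show ?thesis using f(1)[of z] F_0 by simp
    qed (simp add: F_0)
    show "F s > 0" if s: "s > 0"
    proof -
      obtain z where "0 < z" "z < s" "F s - F 0 = (s - 0) * f z"
        using MVT2[of 0 s F f] d s by auto
      then show ?thesis using f(2)[of z] F_0 s by simp
    qed
  qed
qed

text \<open>A \<open>C\<^sup>2\<close> replacement for \<open>(max 0 s)\<^sup>2\<close>: truncating with its derivative \<open>\<psi>\<close> keeps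
  \<open>\<psi> \<circ> u\<close> continuously differentiable in space.\<close>

lemma smooth_truncation:
  obtains \<phi> \<psi> \<rho> :: "real \<Rightarrow> real" where
    "\<And>s. (\<phi> has_real_derivative \<psi> s) (at s)" "\<And>s. (\<psi> has_real_derivative \<rho> s) (at s)"
    "continuous_on UNIV \<rho>" "\<And>s. 0 \<le> \<rho> s" "\<And>s. \<rho> s \<le> 1"
    "\<And>s. s \<le> 0 \<Longrightarrow> \<psi> s = 0" "\<And>s. s > 0 \<Longrightarrow> \<psi> s > 0"
    "\<And>s. s \<le> 0 \<Longrightarrow> \<phi> s = 0" "\<And>s. s > 0 \<Longrightarrow> \<phi> s > 0"
proof -
  \<comment> \<open>Nonnegativity is the convexity of \<open>\<phi>\<close>; the bound 1 makes
    \<open>\<psi>\<close> Lipschitz and the Taylor remainder of \<open>\<phi>\<close>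
    quadratic.\<close>
  define \<rho> :: "real \<Rightarrow> real" where "\<rho> s = max 0 (min 1 s)" for s
  have \<rho>: "continuous_on UNIV \<rho>" unfolding \<rho>_def by (intro continuous_intros)
  obtain \<psi> where \<psi>: "\<And>s. (\<psi> has_real_derivative \<rho> s) (at s)"
    "\<And>s. s \<le> 0 \<Longrightarrow> \<psi> s = 0" "\<And>s. s > 0 \<Longrightarrow> \<psi> s > 0"
    using positive_antiderivative[OF \<rho>] by (auto simp: \<rho>_def)
  have "continuous_on UNIV \<psi>" using \<psi>(1) DERIV_continuous_on by blast
  then obtain \<phi> where "\<And>s. (\<phi> has_real_derivative \<psi> s) (at s)"
    "\<And>s. s \<le> 0 \<Longrightarrow> \<phi> s = 0" "\<And>s. s > 0 \<Longrightarrow> \<phi> s > 0"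
    using positive_antiderivative[of \<psi>] \<psi> by metis
  then show ?thesis using that[of \<phi> \<psi> \<rho>] \<psi> \<rho> by (auto simp: \<rho>_def)
qed

text \<open>There is no time derivative at a fixed x, so the chain rule is applied to the integral.
  The first-order Taylor error of \<open>\<phi>\<close> is at most the square of the increment;
  divided by s - t and integrated, it is at most |s - t| times the squared L2 norm of the difference
  quotient, which stays bounded.\<close>

lemma truncation_energy_deriv:
  fixes \<phi> \<psi> \<rho> :: "real \<Rightarrow> real"
  assumes d\<phi>: "\<And>s. (\<phi> has_real_derivative \<psi> s) (at s)"
    and d\<psi>: "\<And>s. (\<psi> has_real_derivative \<rho> s) (at s)"
    and \<rho>: "\<And>s. 0 \<le> \<rho> s" "\<And>s. \<rho> s \<le> 1"
    and w: "has_L2_time_deriv z w t" and zc: "\<And>s. s \<ge> 0 \<Longrightarrow> continuous_on {0..1} (\<lambda>x. z x s)"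
    and t: "t \<ge> 0"
  shows "((\<lambda>s. \<integral>x. \<phi> (z x s) \<partial>leb01) has_real_derivative (\<integral>x. \<psi> (z x t) * w x \<partial>leb01)) (at t within {0..})"
proof -
  have \<phi>c: "continuous_on S \<phi>" and \<psi>c: "continuous_on S \<psi>" for S
    using d\<phi> d\<psi> by (meson DERIV_continuous_on has_field_derivative_at_within)+
  have lip: "\<bar>\<psi> a - \<psi> b\<bar> \<le> \<bar>a - b\<bar>" for a b
  proof -
    have "norm (\<psi> a - \<psi> b) \<le> 1 * norm (a - b)"
      using d\<psi> \<rho> by (intro field_differentiable_bound[of UNIV \<psi> \<rho>]) (auto simp: has_field_derivative_at_within)
    then show ?thesis by simp
  qed
  have mvt: "\<bar>\<phi> b - \<phi> a - \<psi> a * (b - a)\<bar> \<le> (b - a)\<^sup>2" for a b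
  proof -
    have lt: "\<exists>c. \<bar>c - a\<bar> \<le> \<bar>b - a\<bar> \<and> \<phi> b - \<phi> a = (b - a) * \<psi> c"
    proof (cases a b rule: linorder_cases)
      case less
      obtain c where "a < c" "c < b" "\<phi> b - \<phi> a = (b - a) * \<psi> c" using MVT2[OF less d\<phi>] by auto
      then show ?thesis by (intro exI[of _ c]) auto
    next
      case greater
      obtain c where "b < c" "c < a" "\<phi> a - \<phi> b = (a - b) * \<psi> c" using MVT2[OF greater d\<phi>] by auto
      then show ?thesis by (intro exI[of _ c]) (auto simp: algebra_simps)
    qed auto
    then obtain c where c: "\<bar>c - a\<bar> \<le> \<bar>b - a\<bar>" "\<phi> b - \<phi> a = (b - a) * \<psi> c" by blast
    have "\<bar>\<phi> b - \<phi> a - \<psi> a * (b - a)\<bar> = \<bar>b - a\<bar> * \<bar>\<psi> c - \<psi> a\<bar>"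
      unfolding c(2) by (simp add: abs_mult[symmetric] algebra_simps)
    also have "\<dots> \<le> \<bar>b - a\<bar> * \<bar>b - a\<bar>" using lip[of c a] c(1) by (intro mult_left_mono) auto
    finally show ?thesis by (simp add: power2_eq_square abs_mult_self_eq)
  qed
  have wL: "w \<in> L2" using w by (simp add: has_L2_time_deriv_def)
  have zL: "(\<lambda>x. z x s) \<in> L2" if "s \<ge> 0" for s using zc[OF that] by (rule L2_continuous)
  have \<psi>z: "continuous_on {0..1} (\<lambda>x. \<psi> (z x t))"
    using continuous_on_compose2[OF \<psi>c[of UNIV] zc[OF t]] by simp
  then have "bounded ((\<lambda>x. \<psi> (z x t)) ` {0..1})" by (intro compact_imp_bounded compact_continuous_image) auto
  then obtain M where "\<forall>x\<in>{0..1}. \<bar>\<psi> (z x t)\<bar> \<le> M" by (auto simp: bounded_iff)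
  then have M: "\<bar>\<psi> (z x t)\<bar> \<le> M" if "x \<in> {0..1}" for x using that by blast
  have M0: "M \<ge> 0" using M[of 0] by simp
  have \<phi>i: "integrable leb01 (\<lambda>x. \<phi> (z x s))" if "s \<ge> 0" for s
    using continuous_on_compose2[OF \<phi>c[of UNIV] zc[OF that]] by (intro integrable_leb01_continuous) simp
  have \<psi>w: "integrable leb01 (\<lambda>x. \<psi> (z x t) * w x)"
    using L2_continuous[OF \<psi>z] wL by (rule L2_product_integrable)
  define q where "q s x = (z x s - z x t) / (s - t)" for s x
  define n where "n s = L2_norm (\<lambda>x. q s x - w x)" for s
  have n0: "(n \<longlongrightarrow> 0) (at t within {0..})"
    using w unfolding has_L2_time_deriv_def n_def[abs_def] q_def by blast
  define G where "G s = (\<integral>x. \<phi> (z x s) \<partial>leb01)" for s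
  define D where "D = (\<integral>x. \<psi> (z x t) * w x \<partial>leb01)"
  define W where "W = L2_norm w"
  \<comment> \<open>The first term is the L2 error of the difference quotient, tested against the
    bounded function \<open>\<psi> (z x t)\<close>. The second is the Taylor remainder, with the
    quotient split into its limit \<open>w\<close> and that error.\<close>
  have est: "\<bar>(G s - G t) / (s - t) - D\<bar> \<le> M * n s + \<bar>s - t\<bar> * (2 * (n s)\<^sup>2 + 2 * W\<^sup>2)"
    if s: "s \<ge> 0" "s \<noteq> t" for s
  proof -
    have qL: "q s \<in> L2"
      using L2_lincomb[OF zL[OF s(1)] zL[OF t], of "1 / (s - t)" "- 1 / (s - t)"]
      unfolding q_def[abs_def] by (simp add: diff_divide_distrib)
    have qwL: "(\<lambda>x. q s x - w x) \<in> L2" using qL wL by (rule L2_diff)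
    have ia: "integrable leb01 (\<lambda>x. \<bar>q s x - w x\<bar>)" using L2_integrable[OF qwL] by simp
    have ib: "integrable leb01 (\<lambda>x. (q s x)\<^sup>2)" using L2_sq_integrable[OF qL] .
    have i1: "integrable leb01 (\<lambda>x. (\<phi> (z x s) - \<phi> (z x t)) / (s - t) - \<psi> (z x t) * w x)"
      using \<phi>i[OF s(1)] \<phi>i[OF t] \<psi>w by simp
    have eq: "(G s - G t) / (s - t) - D = (\<integral>x. (\<phi> (z x s) - \<phi> (z x t)) / (s - t) - \<psi> (z x t) * w x \<partial>leb01)"
      unfolding G_def D_def using \<phi>i[OF s(1)] \<phi>i[OF t] \<psi>w by simp
    have "\<bar>(G s - G t) / (s - t) - D\<bar> \<le> (\<integral>x. M * \<bar>q s x - w x\<bar> + \<bar>s - t\<bar> * (q s x)\<^sup>2 \<partial>leb01)"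
      unfolding eq
    proof (rule integral_abs_bound_integral[OF i1])
      show "integrable leb01 (\<lambda>x. M * \<bar>q s x - w x\<bar> + \<bar>s - t\<bar> * (q s x)\<^sup>2)" using ia ib by simp
      fix x assume "x \<in> space leb01"
      then have x: "x \<in> {0..1}" by (simp add: space_restrict_space)
      have zq: "z x s - z x t = q s x * (s - t)" using s by (simp add: q_def)
      have "(\<phi> (z x s) - \<phi> (z x t)) / (s - t) - \<psi> (z x t) * w x =
        \<psi> (z x t) * (q s x - w x) + (\<phi> (z x s) - \<phi> (z x t) - \<psi> (z x t) * (z x s - z x t)) / (s - t)"
        using s unfolding zq by (simp add: field_simps)
      moreover have "\<bar>\<psi> (z x t) * (q s x - w x)\<bar> \<le> M * \<bar>q s x - w x\<bar>"
        unfolding abs_mult using M[OF x] by (intro mult_right_mono) auto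
      moreover have "\<bar>(\<phi> (z x s) - \<phi> (z x t) - \<psi> (z x t) * (z x s - z x t)) / (s - t)\<bar> \<le> \<bar>s - t\<bar> * (q s x)\<^sup>2"
      proof -
        have "\<bar>(\<phi> (z x s) - \<phi> (z x t) - \<psi> (z x t) * (z x s - z x t)) / (s - t)\<bar>
            \<le> (z x s - z x t)\<^sup>2 / \<bar>s - t\<bar>"
          unfolding abs_divide using mvt by (intro divide_right_mono) auto
        also have "\<dots> = (q s x)\<^sup>2 * \<bar>s - t\<bar>\<^sup>2 / \<bar>s - t\<bar>" unfolding zq by (simp add: power_mult_distrib)
        also have "\<dots> = \<bar>s - t\<bar> * (q s x)\<^sup>2"
        proof -
          have "(q s x)\<^sup>2 * d\<^sup>2 / d = d * (q s x)\<^sup>2" if "d \<noteq> 0" for d :: real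
            using that by (simp add: power2_eq_square)
          moreover have "\<bar>s - t\<bar> \<noteq> 0" using s by simp
          ultimately show ?thesis by blast
        qed
        finally show ?thesis .
      qed
      ultimately show "\<bar>(\<phi> (z x s) - \<phi> (z x t)) / (s - t) - \<psi> (z x t) * w x\<bar>
          \<le> M * \<bar>q s x - w x\<bar> + \<bar>s - t\<bar> * (q s x)\<^sup>2" by linarith
    qed
    also have "\<dots> = M * (\<integral>x. \<bar>q s x - w x\<bar> \<partial>leb01) + \<bar>s - t\<bar> * (L2_norm (q s))\<^sup>2"
      unfolding L2_norm_power2
      by (subst Bochner_Integration.integral_add[OF integrable_mult_right[OF ia] integrable_mult_right[OF ib]])
        (simp only: integral_mult_right_zero)
    also have "\<dots> \<le> M * n s + \<bar>s - t\<bar> * (2 * (n s)\<^sup>2 + 2 * W\<^sup>2)"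
    proof (intro add_mono mult_left_mono)
      show "(\<integral>x. \<bar>q s x - w x\<bar> \<partial>leb01) \<le> n s" unfolding n_def using qwL by (rule integral_abs_le_L2_norm)
      have "L2_norm (q s) \<le> sqrt (2 * (n s)\<^sup>2 + 2 * W\<^sup>2)"
        using L2_norm_lincomb_le[OF qwL wL, of 1 1] by (simp add: n_def W_def)
      then have "(L2_norm (q s))\<^sup>2 \<le> (sqrt (2 * (n s)\<^sup>2 + 2 * W\<^sup>2))\<^sup>2"
        using L2_norm_nonneg by (rule power_mono)
      then show "(L2_norm (q s))\<^sup>2 \<le> 2 * (n s)\<^sup>2 + 2 * W\<^sup>2" by simp
    qed (use M0 in auto)
    finally show ?thesis .
  qed
  have "((\<lambda>s. (G s - G t) / (s - t) - D) \<longlongrightarrow> 0) (at t within {0..})"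
  proof (rule Lim_null_comparison)
    show "\<forall>\<^sub>F s in at t within {0..}. norm ((G s - G t) / (s - t) - D)
        \<le> M * n s + \<bar>s - t\<bar> * (2 * (n s)\<^sup>2 + 2 * W\<^sup>2)"
      unfolding eventually_at_filter using est by (intro always_eventually) auto
    have "((\<lambda>s. M * n s + \<bar>s - t\<bar> * (2 * (n s)\<^sup>2 + 2 * W\<^sup>2)) \<longlongrightarrow> M * 0 + \<bar>t - t\<bar> * (2 * 0\<^sup>2 + 2 * W\<^sup>2)) (at t within {0..})"
      by (intro tendsto_intros n0)
    then show "((\<lambda>s. M * n s + \<bar>s - t\<bar> * (2 * (n s)\<^sup>2 + 2 * W\<^sup>2)) \<longlongrightarrow> 0) (at t within {0..})" by simp
  qed
  then have "(G has_real_derivative D) (at t within {0..})"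
    unfolding has_field_derivative_iff by (simp add: LIM_zero_iff)
  then show ?thesis unfolding G_def[abs_def] D_def .
qed

text \<open>Integration by parts leaves minus the integral of
  \<open>\<rho> (h x) * (h' x)\<^sup>2\<close> and two boundary terms. A boundary term vanishes
  where \<open>h\<close> is nonpositive, since \<open>\<psi>\<close> does, and otherwise the sign of
  \<open>h'\<close> decides; hence the alternatives in \<open>bc\<close>.\<close>

lemma truncation_flux_nonpos:
  fixes \<psi> \<rho> :: "real \<Rightarrow> real"
  assumes d\<psi>: "\<And>s. (\<psi> has_real_derivative \<rho> s) (at s)" and \<rho>c: "continuous_on UNIV \<rho>"
    and \<rho>: "\<And>s. 0 \<le> \<rho> s" and \<psi>: "\<And>s. s \<le> 0 \<Longrightarrow> \<psi> s = 0" "\<And>s. 0 \<le> \<psi> s"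
    and h: "H2_derivs h h' g"
    and bc: "h 0 \<le> 0 \<or> h' 0 \<ge> 0" "h 1 \<le> 0 \<or> h' 1 \<le> 0"
  shows "(\<integral>x. g x * \<psi> (h x) \<partial>leb01) \<le> 0"
proof -
  have \<psi>c: "continuous_on UNIV \<psi>" using d\<psi> by (meson DERIV_continuous_on has_field_derivative_at_within)
  have hc: "continuous_on {0..1} h" "continuous_on {0..1} h'" using H2_derivs_continuous[OF h] by auto
  have \<psi>h: "continuous_on {0..1} (\<lambda>x. \<psi> (h x))" "continuous_on {0..1} (\<lambda>x. \<rho> (h x))"
    using continuous_on_compose2[OF \<psi>c hc(1)] continuous_on_compose2[OF \<rho>c hc(1)] by auto
  have gL: "g \<in> L2" using h by (simp add: H2_derivs_def)
  have "((\<lambda>x. g x * \<psi> (h x)) has_integral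
      (h' 1 * \<psi> (h 1) - h' 0 * \<psi> (h 0) - integral {0..1} (\<lambda>x. h' x * (\<rho> (h x) * h' x)))) {0..1}"
  proof (rule has_integral_by_parts_indefinite)
    show "g absolutely_integrable_on {0..1}"
      using L2_integrable[OF gL] by (simp add: integrable_leb01_iff)
    show "continuous_on {0..1} (\<lambda>x. \<rho> (h x) * h' x)" by (intro continuous_intros \<psi>h hc)
    fix x :: real assume x: "x \<in> {0..1}"
    show "(g has_integral (h' x - h' 0)) {0..x}" using h x by (simp add: H2_derivs_def)
    have "(h has_real_derivative h' x) (at x within {0..1})" using h x by (simp add: H2_derivs_def)
    then show "((\<lambda>x. \<psi> (h x)) has_real_derivative \<rho> (h x) * h' x) (at x within {0..1})"
      by (rule DERIV_chain2[OF d\<psi>])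
  qed simp
  moreover have "integral {0..1} (\<lambda>x. h' x * (\<rho> (h x) * h' x)) \<ge> 0"
  proof (rule integral_nonneg)
    show "(\<lambda>x. h' x * (\<rho> (h x) * h' x)) integrable_on {0..1}"
      by (intro integrable_continuous_real continuous_intros \<psi>h hc)
    fix x
    have "h' x * (\<rho> (h x) * h' x) = \<rho> (h x) * (h' x)\<^sup>2" by (simp add: power2_eq_square)
    then show "0 \<le> h' x * (\<rho> (h x) * h' x)" using mult_nonneg_nonneg[OF \<rho> zero_le_power2] by metis
  qed
  moreover have "h' 1 * \<psi> (h 1) \<le> 0" using bc(2) \<psi> by (auto simp: mult_nonpos_nonneg)
  moreover have "h' 0 * \<psi> (h 0) \<ge> 0" using bc(1) \<psi> by auto
  moreover have "(\<integral>x. g x * \<psi> (h x) \<partial>leb01) = integral {0..1} (\<lambda>x. g x * \<psi> (h x))"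
    using gL L2_continuous[OF \<psi>h(1)] by (intro integral_leb01 L2_product_integrable)
  ultimately show ?thesis by (auto simp: has_integral_iff)
qed

text \<open>A weak maximum principle. The alternative at each end point covers Dirichlet, Neumann
  and Robin conditions together, and may switch with time.\<close>

proposition strong_solution_nonpos:
  assumes z: "strong_solution \<alpha> lam f z" and \<alpha>: "\<alpha> \<ge> 0" and lam: "lam \<ge> 0"
    and f: "\<And>x t. 0 < x \<Longrightarrow> x < 1 \<Longrightarrow> 0 < t \<Longrightarrow> t \<le> T \<Longrightarrow> f x t \<le> 0"
    and init: "\<And>x. 0 < x \<Longrightarrow> x < 1 \<Longrightarrow> z x 0 \<le> 0"
    and left: "\<And>t. 0 < t \<Longrightarrow> t \<le> T \<Longrightarrow> z 0 t \<le> 0 \<or> dx (\<lambda>x. z x t) 0 \<ge> 0"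
    and right: "\<And>t. 0 < t \<Longrightarrow> t \<le> T \<Longrightarrow> z 1 t \<le> 0 \<or> dx (\<lambda>x. z x t) 1 \<le> 0"
    and t: "0 \<le> t" "t \<le> T" and x: "x \<in> {0..1}"
  shows "z x t \<le> 0"
proof -
  obtain \<phi> \<psi> \<rho> :: "real \<Rightarrow> real" where cut:
    "\<And>s. (\<phi> has_real_derivative \<psi> s) (at s)" "\<And>s. (\<psi> has_real_derivative \<rho> s) (at s)"
    "continuous_on UNIV \<rho>" "\<And>s. 0 \<le> \<rho> s" "\<And>s. \<rho> s \<le> 1"
    "\<And>s. s \<le> 0 \<Longrightarrow> \<psi> s = 0" "\<And>s. s > 0 \<Longrightarrow> \<psi> s > 0"
    "\<And>s. s \<le> 0 \<Longrightarrow> \<phi> s = 0" "\<And>s. s > 0 \<Longrightarrow> \<phi> s > 0"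
    by (rule smooth_truncation) blast
  have \<psi>0: "0 \<le> \<psi> s" for s using cut(6,7)[of s] by (cases "s \<le> 0") auto
  have \<phi>0: "0 \<le> \<phi> s" for s using cut(8,9)[of s] by (cases "s \<le> 0") auto
  have zc: "continuous_on {0..1} (\<lambda>x. z x s)" if "s \<ge> 0" for s
    using strong_solution_continuous[OF z that] .
  define G where "G s = (\<integral>x. \<phi> (z x s) \<partial>leb01)" for s
  have der: "\<exists>D. (G has_real_derivative D) (at s within {0..}) \<and> (0 < s \<and> s \<le> T \<longrightarrow> D \<le> 0)" if s: "s \<ge> 0" for s
  proof -
    obtain g w where gw: "H2_derivs (\<lambda>x. z x s) (dx (\<lambda>x. z x s)) g" "has_L2_time_deriv z w s"
      "s > 0 \<Longrightarrow> AE x in leb01. w x = \<alpha> * g x - lam * z x s + f x s"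
      using z s unfolding strong_solution_def by blast
    have "(G has_real_derivative (\<integral>x. \<psi> (z x s) * w x \<partial>leb01)) (at s within {0..})"
      unfolding G_def[abs_def] by (rule truncation_energy_deriv[OF cut(1,2,4,5) gw(2) zc s])
    moreover have "(\<integral>x. \<psi> (z x s) * w x \<partial>leb01) \<le> 0" if "0 < s" "s \<le> T"
    proof -
      have \<psi>c: "continuous_on UNIV \<psi>" using cut(2) by (meson DERIV_continuous_on has_field_derivative_at_within)
      have \<psi>L: "(\<lambda>x. \<psi> (z x s)) \<in> L2"
        using continuous_on_compose2[OF \<psi>c zc[OF s]] by (intro L2_continuous) simp
      have L: "w \<in> L2" "g \<in> L2" using gw by (auto simp: has_L2_time_deriv_def H2_derivs_def)
      have "(\<integral>x. \<psi> (z x s) * w x \<partial>leb01) \<le> (\<integral>x. \<alpha> * (g x * \<psi> (z x s)) \<partial>leb01)"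
      proof (rule integral_mono_AE)
        show "integrable leb01 (\<lambda>x. \<psi> (z x s) * w x)" using \<psi>L L by (intro L2_product_integrable)
        show "integrable leb01 (\<lambda>x. \<alpha> * (g x * \<psi> (z x s)))"
          using L2_product_integrable[OF L(2) \<psi>L] by simp
        show "AE x in leb01. \<psi> (z x s) * w x \<le> \<alpha> * (g x * \<psi> (z x s))"
          using gw(3)[OF that(1)] AE_space
        proof eventually_elim
          case (elim x)
          then have x: "0 < x" "x < 1" by (auto simp: space_restrict_space)
          \<comment> \<open>Where \<open>z\<close> is positive, source and damping both push it
            down; elsewhere \<open>\<psi>\<close> vanishes.\<close>
          have "\<psi> (z x s) * (f x s - lam * z x s) \<le> 0"
          proof (cases "z x s \<le> 0")
            case False
            then have "f x s - lam * z x s \<le> 0" using f[OF x that] lam mult_nonneg_nonneg[of lam "z x s"] by linarith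
            then show ?thesis using \<psi>0 by (intro mult_nonneg_nonpos) auto
          qed (simp add: cut(6))
          then show ?case unfolding elim(1) by (simp add: algebra_simps)
        qed
      qed
      also have "\<dots> = \<alpha> * (\<integral>x. g x * \<psi> (z x s) \<partial>leb01)" by simp
      also have "\<dots> \<le> 0"
        using truncation_flux_nonpos[OF cut(2,3,4,6) \<psi>0 gw(1) left[OF that] right[OF that]] \<alpha>
        by (intro mult_nonneg_nonpos)
      finally show ?thesis .
    qed
    ultimately show ?thesis by blast
  qed
  \<comment> \<open>The equation holds only at positive times, so the sign of the derivative is
    known on the open interval and continuity of \<open>G\<close> supplies the end point 0.\<close>
  have "G t \<le> G 0"
  proof (rule DERIV_nonpos_imp_decreasing_open[OF t(1)])
    fix s assume "0 < s" "s < t"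
    then show "\<exists>D. (G has_real_derivative D) (at s) \<and> D \<le> 0"
      using der[of s] t at_within_interior[of s "{0..}"] by auto
  next
    have "continuous_on {0..} G"
      unfolding continuous_on_eq_continuous_within using der by (meson DERIV_continuous atLeast_iff)
    then show "continuous_on {0..t} G" by (rule continuous_on_subset) auto
  qed
  moreover have "G 0 = 0"
  proof -
    have "G 0 = (\<integral>x. 0 \<partial>leb01)" unfolding G_def
      by (rule Bochner_Integration.integral_cong) (auto simp: space_restrict_space cut(8) init)
    then show ?thesis by simp
  qed
  moreover have "continuous_on UNIV \<phi>" using cut(1) by (meson DERIV_continuous_on has_field_derivative_at_within)
  from continuous_on_compose2[OF this zc[OF t(1)]] have c: "continuous_on {0..1} (\<lambda>x. \<phi> (z x t))" by simp
  have "G t \<ge> 0" unfolding G_def using \<phi>0 by simp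
  ultimately have "G t = 0" by simp
  then have "((\<lambda>x. \<phi> (z x t)) has_integral 0) (cbox 0 1)"
    using integral_leb01[OF integrable_leb01_continuous[OF c]] integrable_continuous_real[OF c]
    by (simp add: G_def has_integral_iff)
  then have "\<phi> (z x t) = 0"
    by (rule has_integral_0_cbox_imp_0[rotated 2]) (use c x \<phi>0 in auto)
  then show ?thesis using cut(9)[of "z x t"] by force
qed

text \<open>Comparison of both \<open>u\<close> and \<open>-u\<close> with the barrier. In
  \<open>left\<close>, the Neumann alternative is the one needed for the observer error, whose value
  at 0 is not prescribed; the other components use the Dirichlet alternative.\<close>

theorem strong_solution_decay:
  assumes u: "strong_solution \<alpha> lam f u" and \<alpha>: "\<alpha> \<ge> 0" and lam: "lam \<ge> 0" and l: "l \<ge> 0"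
    and f: "\<And>x t. 0 < x \<Longrightarrow> x < 1 \<Longrightarrow> 0 < t \<Longrightarrow> t \<le> T \<Longrightarrow> \<bar>f x t\<bar> \<le> (lam - \<sigma>) * (K * exp (- \<sigma> * t))"
    and init: "\<And>x. 0 < x \<Longrightarrow> x < 1 \<Longrightarrow> \<bar>u x 0\<bar> \<le> K"
    and left: "\<And>t. 0 < t \<Longrightarrow> t \<le> T \<Longrightarrow> \<bar>u 0 t\<bar> \<le> K * exp (- \<sigma> * t) \<or> dx (\<lambda>x. u x t) 0 = 0"
    and right: "\<And>t. 0 < t \<Longrightarrow> t \<le> T \<Longrightarrow>
       \<bar>dx (\<lambda>x. u x t) 1 + l * u 1 t\<bar> \<le> l * (K * exp (- \<sigma> * t))"
    and t: "0 \<le> t" "t \<le> T" and x: "x \<in> {0..1}"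
  shows "\<bar>u x t\<bar> \<le> K * exp (- \<sigma> * t)"
proof -
  have "s * u x t + (-1) * (K * exp (- \<sigma> * t)) \<le> 0" if s: "s = 1 \<or> s = -1" for s
  proof (rule strong_solution_nonpos[OF strong_solution_lincomb[OF u strong_solution_exp] \<alpha> lam, where T = T])
    fix x t :: real assume "0 < x" "x < 1" "0 < t" "t \<le> T"
    from f[OF this] s show "s * f x t + (-1) * ((lam - \<sigma>) * (K * exp (- \<sigma> * t))) \<le> 0" by auto
  next
    fix x :: real assume "0 < x" "x < 1"
    from init[OF this] s show "s * u x 0 + (-1) * (K * exp (- \<sigma> * 0)) \<le> 0" by auto
  next
    fix t :: real assume t: "0 < t" "t \<le> T"
    have dxz: "dx (\<lambda>x. s * u x t + (-1) * (K * exp (- \<sigma> * t))) y = s * dx (\<lambda>x. u x t) y" if "y \<in> {0..1}" for y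
      using dx_lincomb[OF u strong_solution_exp, of t y s "-1" K \<sigma>] t that by (simp add: dx_const)
    show "s * u 0 t + (-1) * (K * exp (- \<sigma> * t)) \<le> 0 \<or> dx (\<lambda>x. s * u x t + (-1) * (K * exp (- \<sigma> * t))) 0 \<ge> 0"
      using left[OF t] s by (subst dxz) auto
    show "s * u 1 t + (-1) * (K * exp (- \<sigma> * t)) \<le> 0 \<or> dx (\<lambda>x. s * u x t + (-1) * (K * exp (- \<sigma> * t))) 1 \<le> 0"
    proof (cases "s * u 1 t + (-1) * (K * exp (- \<sigma> * t)) \<le> 0")
      case False
      \<comment> \<open>If \<open>s * u\<close> exceeds the barrier at x = 1, the term
        \<open>l * u\<close> alone uses up the whole Robin bound, so the outward derivative of
        \<open>s * u\<close> cannot be positive.\<close>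
      then have "l * (K * exp (- \<sigma> * t)) \<le> l * (s * u 1 t)" using l by (intro mult_left_mono) auto
      then have "s * dx (\<lambda>x. u x t) 1 \<le> 0" using right[OF t] s by auto
      then show ?thesis by (subst dxz) auto
    qed simp
  qed (use t x in auto)
  from this[of 1] this[of "-1"] show ?thesis by auto
qed

section \<open>The cyclic gain inequality\<close>

text \<open>The gain collected over m steps back from agent i. Subtraction is on \<open>nat\<close>,
  so the definition is meant for m \<le> i; a walk that passes agent 1 is written as a second chain
  starting at N.\<close>

definition chain_gain :: "real \<Rightarrow> (nat \<Rightarrow> real) \<Rightarrow> nat \<Rightarrow> nat \<Rightarrow> real" where
  "chain_gain l k i m = (\<Prod>j<m. k (i - j) / l)"

lemma chain_gain_eq: "chain_gain l k i m = (\<Prod>j<m. k (i - j)) / l ^ m"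
  unfolding chain_gain_def by (simp add: prod_dividef)

lemma chain_gain_interval: "m \<le> i \<Longrightarrow> chain_gain l k i m = (\<Prod>n\<in>{i-m<..i}. k n / l)"
  unfolding chain_gain_def
  by (rule prod.reindex_bij_witness[of _ "\<lambda>n. i - n" "\<lambda>j. i - j"]) auto

lemma chain_gain_nonneg:
  assumes "l > 0" "\<And>n. n \<in> {1..N} \<Longrightarrow> 0 < k n" "m \<le> i" "i \<le> N"
  shows "chain_gain l k i m \<ge> 0"
proof -
  have "\<And>n. n \<in> {i-m<..i} \<Longrightarrow> 0 \<le> k n / l" using assms by (simp add: less_imp_le)
  then show ?thesis unfolding chain_gain_interval[OF assms(3)] by (rule prod_nonneg)
qed

lemma loop_gain_eq: "loop_gain N l k = (\<Prod>n=1..N. k n / l)"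
  unfolding loop_gain_def by (simp add: prod_dividef)

text \<open>Walking from i down to 1 and then from N down to i + 1 meets every agent once.\<close>

lemma loop_gain_split:
  assumes "i \<le> N"
  shows "loop_gain N l k = chain_gain l k i i * chain_gain l k N (N - i)"
proof -
  have "{1..N} = {i - i<..i} \<union> {N - (N - i)<..N}" using assms by auto
  moreover have "{i - i<..i} \<inter> {N - (N - i)<..N} = {}" using assms by auto
  ultimately show ?thesis
    by (simp add: loop_gain_eq chain_gain_interval prod.union_disjoint)
qed

lemma loop_gain_less_1:
  assumes "N \<ge> 1" "l > 0" "\<And>n. n \<in> {1..N} \<Longrightarrow> 0 < k n \<and> k n < l"
  shows "loop_gain N l k < 1"
proof -
  have "(\<Prod>n=1..N. k n / l) < (\<Prod>n=1..N. 1)"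
    using assms by (intro prod_mono_strict) (auto simp: less_imp_le)
  then show ?thesis by (simp add: loop_gain_eq)
qed

text \<open>Identifies \<open>M_const\<close> with the gains summed along one turn around the cycle.
  For i < N both sides agree; for i = N the first sum in \<open>M_const\<close> runs up to m = N and
  also contains the full loop gain, hence an inequality.\<close>

lemma M_const_ge:
  assumes l: "l > 0" and k: "\<And>n. n \<in> {1..N} \<Longrightarrow> 0 < k n" and i: "i \<in> {1..N}"
  shows "(\<Sum>m<i. chain_gain l k i m) + chain_gain l k i i * (\<Sum>m<N-i. chain_gain l k N m) \<le> M_const N l k i"
proof -
  have set: "{0..m-1} = {..<m}" if "m \<ge> 1" for m :: nat using that by auto
  have "1 + (\<Sum>m=1..i. (\<Prod>j=0..m-1. k (i - j)) / l ^ m) = 1 + (\<Sum>m=1..i. chain_gain l k i m)"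
    unfolding chain_gain_eq by (intro arg_cong2[of _ _ _ _ "(+)"] refl sum.cong) (simp add: set del: One_nat_def)
  also have "\<dots> = (\<Sum>m<Suc i. chain_gain l k i m)"
  proof -
    have "{..<Suc i} = insert 0 {1..i}" by auto
    then show ?thesis by (simp add: chain_gain_def)
  qed
  finally have a: "1 + (\<Sum>m=1..i. (\<Prod>j=0..m-1. k (i - j)) / l ^ m) =
      (\<Sum>m<i. chain_gain l k i m) + chain_gain l k i i" by simp
  have "(\<Sum>m=i+1..N-1. (\<Prod>j=0..i-1. k (i - j)) * (\<Prod>s=0..m-i-1. k (N - s)) / l ^ m) =
     (\<Sum>m=i+1..N-1. chain_gain l k i i * chain_gain l k N (m - i))"
  proof (intro sum.cong refl)
    fix m assume m: "m \<in> {i+1..N-1}"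
    then have lm: "l ^ m = l ^ i * l ^ (m - i)" by (simp add: power_add[symmetric])
    have e: "{0..i-1} = {..<i}" "{0..m-i-1} = {..<m-i}" using m i by auto
    then show "(\<Prod>j=0..i-1. k (i - j)) * (\<Prod>s=0..m-i-1. k (N - s)) / l ^ m =
        chain_gain l k i i * chain_gain l k N (m - i)"
      unfolding chain_gain_eq e lm by simp
  qed
  also have "\<dots> = chain_gain l k i i * (\<Sum>m=i+1..N-1. chain_gain l k N (m - i))"
    by (simp add: sum_distrib_left)
  also have "(\<Sum>m=i+1..N-1. chain_gain l k N (m - i)) = (\<Sum>m=1..N-1-i. chain_gain l k N m)"
    by (rule sum.reindex_bij_witness[of _ "\<lambda>m. m + i" "\<lambda>m. m - i"]) auto
  finally have b: "(\<Sum>m=i+1..N-1. (\<Prod>j=0..i-1. k (i - j)) * (\<Prod>s=0..m-i-1. k (N - s)) / l ^ m) =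
     chain_gain l k i i * (\<Sum>m=1..N-1-i. chain_gain l k N m)" .
  have c: "(\<Sum>m<N-i. chain_gain l k N m) \<le> 1 + (\<Sum>m=1..N-1-i. chain_gain l k N m)"
  proof (cases "i = N")
    case False
    then have "{..<N-i} = insert 0 {1..N-1-i}" using i by auto
    then show ?thesis by (simp add: chain_gain_def)
  qed simp
  have "chain_gain l k i i * (\<Sum>m<N-i. chain_gain l k N m) \<le>
      chain_gain l k i i * (1 + (\<Sum>m=1..N-1-i. chain_gain l k N m))"
    by (intro mult_left_mono c chain_gain_nonneg[OF l, of N]) (use k i in auto)
  then show ?thesis unfolding M_const_def a b by (simp add: algebra_simps)
qed

text \<open>Iterating \<open>step\<close> once around the cycle returns to \<open>A i\<close> with
  factor \<open>loop_gain\<close>, and this term is absorbed on the left because the factor is below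
  1.\<close>

lemma cyclic_gain_bound:
  fixes A :: "nat \<Rightarrow> real"
  assumes N: "N \<ge> 1" and l: "l > 0" and k: "\<And>n. n \<in> {1..N} \<Longrightarrow> 0 < k n \<and> k n < l" and B: "B \<ge> 0"
    and step: "\<And>n. n \<in> {1..N} \<Longrightarrow> A n \<le> B + k n / l * A (cyc N (n - 1))"
    and i: "i \<in> {1..N}"
  shows "A i \<le> C_const N l k i * B"
proof -
  have k0: "\<And>n. n \<in> {1..N} \<Longrightarrow> 0 < k n" using k by auto
  \<comment> \<open>The walk stops at index 0 at the latest, so \<open>cyc\<close> acts only when j
    = i, where it turns 0 into N.\<close>
  have iter: "A i \<le> (\<Sum>m<j. chain_gain l k i m) * B + chain_gain l k i j * A (cyc N (i - j))"
    if "i \<in> {1..N}" "j \<le> i" for i j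
    using that(2)
  proof (induction j)
    case 0
    show ?case using that by (auto simp: chain_gain_def cyc_def)
  next
    case (Suc j)
    then have ij: "i - j \<in> {1..N}" using that by auto
    have "A i \<le> (\<Sum>m<j. chain_gain l k i m) * B + chain_gain l k i j * A (i - j)"
      using Suc ij by (auto simp: cyc_def)
    also have "\<dots> \<le> (\<Sum>m<j. chain_gain l k i m) * B +
        chain_gain l k i j * (B + k (i - j) / l * A (cyc N (i - j - 1)))"
      by (intro add_left_mono mult_left_mono step[OF ij] chain_gain_nonneg[OF l, of N])
        (use k0 that Suc.prems in auto)
    also have "\<dots> = (\<Sum>m<Suc j. chain_gain l k i m) * B + chain_gain l k i (Suc j) * A (cyc N (i - Suc j))"
      by (simp add: chain_gain_def algebra_simps)
    finally show ?case .
  qed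
  let ?P = "chain_gain l k i i" and ?Q = "chain_gain l k N (N - i)"
  let ?S = "\<Sum>m<i. chain_gain l k i m" and ?T = "\<Sum>m<N-i. chain_gain l k N m"
  have P: "?P \<ge> 0" by (rule chain_gain_nonneg[OF l, of N]) (use k0 i in auto)
  have "A i \<le> ?S * B + ?P * A N" using iter[OF i order_refl] by (simp add: cyc_def)
  also have "\<dots> \<le> ?S * B + ?P * (?T * B + ?Q * A i)"
  proof (intro add_left_mono mult_left_mono P)
    have "cyc N (N - (N - i)) = i" using i by (auto simp: cyc_def)
    then show "A N \<le> ?T * B + ?Q * A i" using iter[of N "N - i"] N by simp
  qed
  also have "\<dots> = (?S + ?P * ?T) * B + loop_gain N l k * A i"
    using i by (simp add: loop_gain_split[of i] algebra_simps)
  also have "\<dots> \<le> M_const N l k i * B + loop_gain N l k * A i"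
    using M_const_ge[OF l k0 i] B by (intro add_right_mono mult_right_mono)
  finally have "A i * (1 - loop_gain N l k) \<le> M_const N l k i * B" by (simp add: algebra_simps)
  moreover have "1 - loop_gain N l k > 0" using loop_gain_less_1[OF N l k] by simp
  ultimately show ?thesis by (simp add: C_const_def field_simps)
qed

lemma C_const_nonneg:
  assumes N: "N \<ge> 1" and l: "l > 0" and k: "\<And>n. n \<in> {1..N} \<Longrightarrow> 0 < k n \<and> k n < l" and i: "i \<in> {1..N}"
  shows "C_const N l k i \<ge> 0"
  using cyclic_gain_bound[of N l k 1 "\<lambda>_. 0" i] assms by simp

section \<open>Input-to-state stability\<close>

lemma C_norm_ge:
  assumes "bdd_above ((\<lambda>z. \<bar>h z\<bar>) ` K)" "z \<in> K"
  shows "\<bar>h z\<bar> \<le> C_norm K h"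
  unfolding C_norm_def using assms by (intro cSUP_upper)

lemma C_norm_le:
  assumes "K \<noteq> {}" "\<And>z. z \<in> K \<Longrightarrow> \<bar>h z\<bar> \<le> c"
  shows "C_norm K h \<le> c"
  unfolding C_norm_def using assms by (intro cSUP_least)

lemma bdd_above_continuous:
  fixes h :: "'a::topological_space \<Rightarrow> real"
  assumes "compact K" "continuous_on K h"
  shows "bdd_above ((\<lambda>z. \<bar>h z\<bar>) ` K)"
  using assms by (intro bounded_imp_bdd_above compact_imp_bounded compact_continuous_image continuous_intros)

lemma Max_C_norm_ge:
  assumes "n \<in> {1..N::nat}" "bdd_above ((\<lambda>z. \<bar>h n z\<bar>) ` K)" "z \<in> K"
  shows "\<bar>h n z\<bar> \<le> (MAX n\<in>{1..N}. C_norm K (h n))"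
proof -
  have "C_norm K (h n) \<le> (MAX n\<in>{1..N}. C_norm K (h n))" using assms(1) by (intro Max_ge) auto
  then show ?thesis using C_norm_ge[OF assms(2,3)] by linarith
qed

lemma C1_halfline_continuous: "g \<in> C1_halfline \<Longrightarrow> continuous_on {0..} g"
  unfolding C1_halfline_def by (auto intro: DERIV_continuous_on)

theorem theorem3p4:
  fixes N :: nat and \<alpha> lam l \<sigma> :: real and k :: "nat \<Rightarrow> real"
    and u v qh f :: "nat \<Rightarrow> real \<Rightarrow> real \<Rightarrow> real" and uref :: "real \<Rightarrow> real \<Rightarrow> real"
    and u0 v0 qh0 :: "nat \<Rightarrow> real \<Rightarrow> real" and uref0 :: "real \<Rightarrow> real"
    and U0 U1 d0 d1 q :: "nat \<Rightarrow> real \<Rightarrow> real" and r :: "real \<Rightarrow> real"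
  assumes N: "N \<ge> 2"
    and params: "\<alpha> > 0" "lam > 0" "l > 0" "\<forall>i\<in>{1..N}. 0 < k i \<and> k i < l"
    \<comment> \<open>regularity of the inputs and of the initial data\<close>
    and f_cont: "\<forall>i\<in>{1..N}. continuous_on ({0..1} \<times> {0..}) (\<lambda>(x, t). f i x t)"
    and inputs_C1: "\<forall>i\<in>{1..N}. d0 i \<in> C1_halfline \<and> d1 i \<in> C1_halfline \<and> q i \<in> C1_halfline"
      "r \<in> C1_halfline"
    and init_reg:
      "\<forall>i\<in>{1..N}. (\<lambda>x. u0 i x - uref0 x) \<in> H2 \<and> continuous_on {0..1} (\<lambda>x. u0 i x - uref0 x)"
      "uref0 \<in> H2 \<and> continuous_on {0..1} uref0"
      "\<forall>i\<in>{1..N}. v0 i \<in> H2 \<and> continuous_on {0..1} (v0 i)"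
    \<comment> \<open>control laws\<close>
    and controls:
      "\<forall>i\<in>{1..N}. \<forall>t\<ge>0. U0 i t = r t - qh i 0 t + d0 i t"
      "\<forall>i\<in>{1..N}. \<forall>t\<ge>0. U1 i t = k i * (u (cyc N (i - 1)) 1 t - uref 1 t) + d1 i t"
    \<comment> \<open>compatibility conditions\<close>
    and compat_u:
      "\<forall>i\<in>{1..N}. u0 i 0 - uref0 0 = q i 0 + d0 i 0 - qh0 i 0"
      "\<forall>i\<in>{1..N}. dx (\<lambda>x. u0 i x - uref0 x) 1 =
         - l * (u0 i 1 - uref0 1) + k i * (u0 (cyc N (i - 1)) 1 - uref0 1) + d1 i 0"
    and compat_uref: "uref0 0 = r 0" "dx uref0 1 = - l * uref0 1"
    and compat_v: "\<forall>i\<in>{1..N}. v0 i 0 = U0 i 0"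
      "\<forall>i\<in>{1..N}. dx (v0 i) 1 = - l * v0 i 1 + U1 i 0"
    \<comment> \<open>regularity of the solution\<close>
    and sol_reg: "\<forall>i\<in>{1..N}. regular (u i) \<and> regular (v i) \<and> regular (qh i)" "regular uref"
    \<comment> \<open>agents\<close>
    and agent: "\<forall>i\<in>{1..N}. solves_pde \<alpha> lam (f i) (u i)"
      "\<forall>i\<in>{1..N}. \<forall>t>0. u i 0 t = q i t + U0 i t"
      "\<forall>i\<in>{1..N}. \<forall>t>0. dx (\<lambda>x. u i x t) 1 = - l * u i 1 t + U1 i t"
      "\<forall>i\<in>{1..N}. \<forall>x\<in>{0<..<1}. u i x 0 = u0 i x"
    \<comment> \<open>reference\<close>
    and reference: "solves_pde \<alpha> lam (\<lambda>x t. 0) uref"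
      "\<forall>t>0. uref 0 t = r t"
      "\<forall>t>0. dx (\<lambda>x. uref x t) 1 = - l * uref 1 t"
      "\<forall>x\<in>{0<..<1}. uref x 0 = uref0 x"
    \<comment> \<open>auxiliary system\<close>
    and auxiliary: "\<forall>i\<in>{1..N}. solves_pde \<alpha> lam (\<lambda>x t. 0) (v i)"
      "\<forall>i\<in>{1..N}. \<forall>t>0. v i 0 t = U0 i t"
      "\<forall>i\<in>{1..N}. \<forall>t>0. dx (\<lambda>x. v i x t) 1 = - l * v i 1 t + U1 i t"
      "\<forall>i\<in>{1..N}. \<forall>x\<in>{0<..<1}. v i x 0 = v0 i x"
    \<comment> \<open>disturbance observer\<close>
    and observer: "\<forall>i\<in>{1..N}. solves_pde \<alpha> lam (\<lambda>x t. 0) (qh i)"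
      "\<forall>i\<in>{1..N}. \<forall>t>0. dx (\<lambda>x. qh i x t) 0 = dx (\<lambda>x. u i x t) 0 - dx (\<lambda>x. v i x t) 0"
      "\<forall>i\<in>{1..N}. \<forall>t>0. dx (\<lambda>x. qh i x t) 1 = - l * qh i 1 t"
      "\<forall>i\<in>{1..N}. \<forall>x\<in>{0<..<1}. qh i x 0 = qh0 i x"
    and sigma: "0 < \<sigma>" "\<sigma> < lam"
  shows "\<forall>i\<in>{1..N}. \<forall>t>0.
    C_norm {0..1} (\<lambda>x. u i x t) + C_norm {0..1} (\<lambda>x. uref x t)
      + C_norm {0..1} (\<lambda>x. v i x t) + C_norm {0..1} (\<lambda>x. qh i x t)
    \<le> (1 + 2 * Ct_const N l k i) * exp (- \<sigma> * t)
          * (2 * (MAX n\<in>{1..N}. C_norm {0..1} (u0 n)) + C_norm {0..1} uref0)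
      + (4 + 2 * Ct_const N l k i) * exp (- \<sigma> * t)
          * ((MAX n\<in>{1..N}. C_norm {0..1} (v0 n)) + (MAX n\<in>{1..N}. C_norm {0..1} (qh0 n)))
      + 3 * C_norm {0..t} r + 2 * C_norm {0..t} (q i)
      + (1 + 2 * Ct_const N l k i) * D_term N l lam \<sigma> f d0 d1 t"
proof (intro ballI allI impI)
  fix i :: nat and t :: real
  assume i: "i \<in> {1..N}" and t: "t > 0"
  \<comment> \<open>For s \<le> t the product \<open>X * exp (- \<sigma> * s)\<close> is at least 1,
    so a constant bound on \<open>{0..t}\<close> fits under a decaying barrier at the price of the
    factor \<open>X\<close>.\<close>
  define X where "X = exp (\<sigma> * t)"
  have weight: "c \<le> c * X * exp (- \<sigma> * s)" if "c \<ge> 0" "s \<le> t" for c s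
  proof -
    have "X * exp (- \<sigma> * s) = exp (\<sigma> * (t - s))" by (simp add: X_def exp_add[symmetric] algebra_simps)
    also have "\<dots> \<ge> 1" using that sigma by simp
    finally show ?thesis using mult_left_mono[of 1 "X * exp (- \<sigma> * s)" c] that by (simp add: mult.assoc)
  qed
  have weight1: "a \<le> K * exp (- \<sigma> * s)" if "a \<le> c" "0 \<le> c" "s \<le> t" "c * X \<le> K" for a c s K
  proof -
    have "c * X * exp (- \<sigma> * s) \<le> K * exp (- \<sigma> * s)" using that(4) by (rule mult_right_mono) simp
    then show ?thesis using weight[OF that(2,3)] that(1) by linarith
  qed
  have weight2: "a + b \<le> K * exp (- \<sigma> * s)"
    if "a \<le> K1 * exp (- \<sigma> * s)" "b \<le> c" "0 \<le> c" "s \<le> t" "K1 + c * X \<le> K" for a b c s K K1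
  proof -
    have "(K1 + c * X) * exp (- \<sigma> * s) \<le> K * exp (- \<sigma> * s)" using that(5) by (rule mult_right_mono) simp
    then show ?thesis using weight[OF that(3,4)] that(1,2) unfolding distrib_right by linarith
  qed
  have X0: "X > 0" by (simp add: X_def)
  have cyc: "cyc N (n - 1) \<in> {1..N}" if "n \<in> {1..N}" for n using that by (auto simp: cyc_def)
  have par: "\<And>n. n \<in> {1..N} \<Longrightarrow> 0 < k n \<and> k n < l" "0 \<le> \<alpha>" "0 \<le> lam" "0 \<le> l" "1 \<le> N" using params N by auto

  have Su: "strong_solution \<alpha> lam (f n) (u n)" and Sv: "strong_solution \<alpha> lam (\<lambda>x t. 0) (v n)"
    and Sq: "strong_solution \<alpha> lam (\<lambda>x t. 0) (qh n)" if "n \<in> {1..N}" for n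
    using sol_reg(1) agent(1) auxiliary(1) observer(1) that by (auto intro: strong_solutionI)
  have Sr: "strong_solution \<alpha> lam (\<lambda>x t. 0) uref"
    using sol_reg(2) reference(1) by (rule strong_solutionI)

  \<comment> \<open>Norms of the data and the pointwise bounds they give\<close>
  define U where "U = (MAX n\<in>{1..N}. C_norm {0..1} (u0 n))"
  define V where "V = (MAX n\<in>{1..N}. C_norm {0..1} (v0 n))"
  define Q where "Q = (MAX n\<in>{1..N}. C_norm {0..1} (qh0 n))"
  define R0 where "R0 = C_norm {0..1} uref0"
  define F where "F = (MAX n\<in>{1..N}. C_norm ({0..1} \<times> {0..t}) (\<lambda>(x, s). f n x s))"
  define D0 where "D0 = (MAX n\<in>{1..N}. C_norm {0..t} (d0 n))"
  define D1 where "D1 = (MAX n\<in>{1..N}. C_norm {0..t} (d1 n))"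
  define R where "R = C_norm {0..t} r"
  define Qi where "Qi = C_norm {0..t} (q i)"
  define D where "D = D_term N l lam \<sigma> f d0 d1 t"
  have D_eq: "D = 2 / (lam - \<sigma>) * F + D0 + 1 / l * D1"
    by (simp add: D_def D_term_def F_def D0_def D1_def)

  have U_ge: "\<bar>u0 n x\<bar> \<le> U" if n: "n \<in> {1..N}" and x: "x \<in> {0..1}" for n x
  proof -
    have "continuous_on {0..1} (\<lambda>x. (u0 n x - uref0 x) + uref0 x)"
      using init_reg(1,2) n by (intro continuous_on_add) auto
    then have "continuous_on {0..1} (u0 n)" by simp
    then show ?thesis unfolding U_def by (intro Max_C_norm_ge n x bdd_above_continuous) auto
  qed
  have V_ge: "\<bar>v0 n x\<bar> \<le> V" if n: "n \<in> {1..N}" and x: "x \<in> {0..1}" for n x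
    unfolding V_def using init_reg(3) n by (intro Max_C_norm_ge n x bdd_above_continuous) auto
  have Q_ge: "\<bar>qh0 n x\<bar> \<le> Q" if n: "n \<in> {1..N}" and x: "x \<in> {0..1}" for n x
    unfolding Q_def
  proof (rule Max_C_norm_ge[OF n _ x])
    \<comment> \<open>No regularity is assumed of \<open>qh0\<close>. Inside the interval it equals
      the continuous function \<open>qh n\<close> at time 0, and two further values at the end
      points do not destroy boundedness, so the supremum is meaningful.\<close>
    have "continuous_on {0..1} (\<lambda>x. qh n x 0)" using strong_solution_continuous[OF Sq[OF n]] by simp
    then have "bdd_above ((\<lambda>x. \<bar>qh n x 0\<bar>) ` {0..1})" by (intro bdd_above_continuous) auto
    then have "bdd_above ((\<lambda>x. \<bar>qh n x 0\<bar>) ` {0<..<1})" by (rule bdd_above_mono) auto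
    moreover have "(\<lambda>x. \<bar>qh n x 0\<bar>) ` {0<..<1} = (\<lambda>x. \<bar>qh0 n x\<bar>) ` {0<..<1}"
      using observer(4) n by (intro image_cong) auto
    ultimately have "bdd_above (insert \<bar>qh0 n 0\<bar> (insert \<bar>qh0 n 1\<bar> ((\<lambda>x. \<bar>qh0 n x\<bar>) ` {0<..<1})))" by simp
    then show "bdd_above ((\<lambda>x. \<bar>qh0 n x\<bar>) ` {0..1})"
      by (rule bdd_above_mono) (auto simp: less_le)
  qed
  have R0_ge: "\<bar>uref0 x\<bar> \<le> R0" if "x \<in> {0..1}" for x
    unfolding R0_def using init_reg(2) that by (intro C_norm_ge bdd_above_continuous) auto
  have F_ge: "\<bar>f n x s\<bar> \<le> F" if n: "n \<in> {1..N}" and x: "x \<in> {0..1}" and s: "s \<in> {0..t}" for n x s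
  proof -
    have "continuous_on ({0..1} \<times> {0..t}) (\<lambda>(x, s). f n x s)"
      by (rule continuous_on_subset[OF bspec[OF f_cont n]]) auto
    then have "bdd_above ((\<lambda>z. \<bar>case z of (x, s) \<Rightarrow> f n x s\<bar>) ` ({0..1} \<times> {0..t}))"
      by (intro bdd_above_continuous compact_Times) auto
    with Max_C_norm_ge[OF n, of "\<lambda>n (x, s). f n x s" "{0..1} \<times> {0..t}" "(x, s)"] x s
    show ?thesis by (simp add: F_def)
  qed
  have time_bdd: "bdd_above ((\<lambda>s. \<bar>g s\<bar>) ` {0..t})" if "g \<in> C1_halfline" for g
    using continuous_on_subset[OF C1_halfline_continuous[OF that], of "{0..t}"]
    by (intro bdd_above_continuous) auto
  have D0_ge: "\<bar>d0 n s\<bar> \<le> D0" and D1_ge: "\<bar>d1 n s\<bar> \<le> D1" if n: "n \<in> {1..N}" and s: "s \<in> {0..t}" for n s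
    unfolding D0_def D1_def using inputs_C1(1) n
    by (blast intro: Max_C_norm_ge[of n N d0, OF n time_bdd s] Max_C_norm_ge[of n N d1, OF n time_bdd s])+
  have R_ge: "\<bar>r s\<bar> \<le> R" and Qi_ge: "\<bar>q i s\<bar> \<le> Qi" if s: "s \<in> {0..t}" for s
    unfolding R_def Qi_def using inputs_C1 i by (blast intro: C_norm_ge[OF time_bdd s])+
  have nonneg: "0 \<le> U" "0 \<le> V" "0 \<le> Q" "0 \<le> R0" "0 \<le> F" "0 \<le> D0" "0 \<le> D1" "0 \<le> R" "0 \<le> Qi"
  proof -
    have z: "(0::real) \<in> {0..1}" "0 \<in> {0..t}" using t by auto
    note [THEN order_trans[OF abs_ge_zero]] =
      U_ge[OF i z(1)] V_ge[OF i z(1)] Q_ge[OF i z(1)] R0_ge[OF z(1)] F_ge[OF i z]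
      D0_ge[OF i z(2)] D1_ge[OF i z(2)] R_ge[OF z(2)] Qi_ge[OF z(2)]
    then show "0 \<le> U" "0 \<le> V" "0 \<le> Q" "0 \<le> R0" "0 \<le> F" "0 \<le> D0" "0 \<le> D1" "0 \<le> R" "0 \<le> Qi"
      by blast+
  qed

  \<comment> \<open>The observer error has zero flux at x = 0 and a homogeneous Robin condition at x
    = 1, so only its initial value and \<open>f\<close> contribute.\<close>
  define KE where "KE = U + V + Q + F / (lam - \<sigma>) * X"
  \<comment> \<open>The data that the claim multiplies by \<open>2 * Ct_const N l k i\<close>, up to
    the common factor \<open>exp (- \<sigma> * t)\<close>. \<open>KE_B\<close> lists what the
    barriers below require of it: they have to dominate the initial, source and boundary
    contributions separately, not their sum.\<close>
  define B where "B = 2 * U + R0 + (V + Q) + D * X"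
  have FX: "0 \<le> F / (lam - \<sigma>) * X" using nonneg X0 sigma by simp
  have DX: "0 \<le> D0 * X" "0 \<le> D1 / l * X" using nonneg X0 params by auto
  have DX_eq: "D * X = 2 * (F / (lam - \<sigma>) * X) + D0 * X + D1 / l * X"
    unfolding D_eq by (simp add: algebra_simps)
  have KE0: "0 \<le> KE" unfolding KE_def using nonneg FX by simp
  have KE_B: "KE + D0 * X \<le> B" "KE \<le> B" "D1 / l * X \<le> B" "U + R0 \<le> B" "0 \<le> B" "F / (lam - \<sigma>) * X \<le> B"
    unfolding B_def DX_eq KE_def using nonneg FX DX by auto
  have source: "\<bar>f n x s\<bar> \<le> (lam - \<sigma>) * (K * exp (- \<sigma> * s))"
    if "n \<in> {1..N}" "0 < x" "x < 1" "0 < s" "s \<le> t" "F / (lam - \<sigma>) * X \<le> K" for n x s K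
  proof -
    have "\<bar>f n x s\<bar> \<le> F" using F_ge[of n x s] that by auto
    then have "\<bar>f n x s\<bar> / (lam - \<sigma>) \<le> F / (lam - \<sigma>)" using sigma by (intro divide_right_mono) auto
    then have "\<bar>f n x s\<bar> / (lam - \<sigma>) \<le> K * exp (- \<sigma> * s)"
      using nonneg sigma that by (intro weight1[of _ "F / (lam - \<sigma>)"]) auto
    then show ?thesis using sigma by (simp add: field_simps)
  qed

  \<comment> \<open>Decay of the observer error\<close>
  define e where "e n x s = u n x s - v n x s - qh n x s" for n x s
  have e_bound: "\<bar>e n x s\<bar> \<le> KE * exp (- \<sigma> * s)"
    if n: "n \<in> {1..N}" and x: "x \<in> {0..1}" and s: "0 \<le> s" "s \<le> t" for n x s
  proof -
    have Suv: "strong_solution \<alpha> lam (\<lambda>x t. f n x t - 0) (\<lambda>x t. u n x t - v n x t)"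
      by (rule strong_solution_diff[OF Su[OF n] Sv[OF n]])
    have Se: "strong_solution \<alpha> lam (f n) (e n)"
      using strong_solution_diff[OF Suv Sq[OF n]] by (simp add: e_def[abs_def])
    have dxe: "dx (\<lambda>x. e n x s) y = dx (\<lambda>x. u n x s) y - dx (\<lambda>x. v n x s) y - dx (\<lambda>x. qh n x s) y"
      if "0 < s" "y \<in> {0..1}" for s y
      using dx_diff[OF Suv Sq[OF n], of s y] dx_diff[OF Su[OF n] Sv[OF n], of s y] that
      by (simp add: e_def)
    show ?thesis
    proof (rule strong_solution_decay[OF Se par(2,3,4) _ _ _ _ s x])
      fix x s :: real assume "0 < x" "x < 1" "0 < s" "s \<le> t"
      then show "\<bar>f n x s\<bar> \<le> (lam - \<sigma>) * (KE * exp (- \<sigma> * s))"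
        using n nonneg by (intro source) (auto simp: KE_def)
    next
      fix x :: real assume x: "0 < x" "x < 1"
      then have "e n x 0 = u0 n x - v0 n x - qh0 n x"
        using agent(4) auxiliary(4) observer(4) n by (simp add: e_def)
      then show "\<bar>e n x 0\<bar> \<le> KE"
        using U_ge[OF n, of x] V_ge[OF n, of x] Q_ge[OF n, of x] x FX unfolding KE_def by auto
    next
      fix s :: real assume s: "0 < s" "s \<le> t"
      \<comment> \<open>The flux condition of the observer is exactly the Neumann
        alternative.\<close>
      show "\<bar>e n 0 s\<bar> \<le> KE * exp (- \<sigma> * s) \<or> dx (\<lambda>x. e n x s) 0 = 0"
        using observer(2) n s by (simp add: dxe)
      have bc: "dx (\<lambda>x. u n x s) 1 = - l * u n 1 s + U1 n s" "dx (\<lambda>x. v n x s) 1 = - l * v n 1 s + U1 n s"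
        "dx (\<lambda>x. qh n x s) 1 = - l * qh n 1 s"
        using observer(3) agent(3) auxiliary(3) n s by auto
      have e1: "e n 1 s = u n 1 s - v n 1 s - qh n 1 s" by (simp add: e_def)
      have "dx (\<lambda>x. e n x s) 1 + l * e n 1 s = 0"
        unfolding e1 using dxe[OF s(1), of 1] bc by (simp add: algebra_simps)
      then show "\<bar>dx (\<lambda>x. e n x s) 1 + l * e n 1 s\<bar> \<le> l * (KE * exp (- \<sigma> * s))"
        using KE0 params by simp
    qed
  qed
  have qh_left: "qh n 0 s = q n s - e n 0 s" if "n \<in> {1..N}" "0 < s" for n s
    using agent(2) auxiliary(2) that by (simp add: e_def)
  \<comment> \<open>Inserting \<open>qh_left\<close> into the control law shows how it rejects the
    disturbance: in \<open>q + U0\<close>, the boundary value of the agent, \<open>q\<close> cancels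
    and only the decaying error remains.\<close>
  have U0_eq: "U0 n s = r s - q n s + e n 0 s + d0 n s" if "n \<in> {1..N}" "0 < s" for n s
    using controls(1) qh_left[OF that] that by simp

  \<comment> \<open>Traces at x = 1 around the cycle\<close>
  define y where "y n s = u n 1 s - uref 1 s" for n s
  \<comment> \<open>The weight makes the comparison between neighbours one between constants on the
    same interval \<open>{0..t}\<close>, as \<open>cyclic_gain_bound\<close> requires, and preserves
    the decay.\<close>
  define A where "A n = C_norm {0..t} (\<lambda>s. exp (\<sigma> * s) * y n s)" for n
  have A_ge: "\<bar>y n s\<bar> \<le> A n * exp (- \<sigma> * s)" if n: "n \<in> {1..N}" and s: "s \<in> {0..t}" for n s
  proof -
    have "continuous_on {0..} (u n 1)" "continuous_on {0..} (uref 1)"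
      using Su[OF n] Sr by (auto simp: strong_solution_def)
    then have "continuous_on {0..} (\<lambda>s. exp (\<sigma> * s) * y n s)"
      unfolding y_def by (intro continuous_intros)
    then have "continuous_on {0..t} (\<lambda>s. exp (\<sigma> * s) * y n s)" by (rule continuous_on_subset) auto
    then have "\<bar>exp (\<sigma> * s) * y n s\<bar> \<le> A n"
      unfolding A_def using s by (intro C_norm_ge[of "\<lambda>s. exp (\<sigma> * s) * y n s"] bdd_above_continuous) auto
    then have "exp (\<sigma> * s) * \<bar>y n s\<bar> * exp (- \<sigma> * s) \<le> A n * exp (- \<sigma> * s)"
      by (intro mult_right_mono) (auto simp: abs_mult)
    then show ?thesis by (simp add: exp_minus field_simps)
  qed
  \<comment> \<open>The bound \<open>A'\<close> is left free because \<open>A_step\<close> inserts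
    the norm of the predecessor itself, whereas \<open>robin_i\<close> inserts the estimate that the
    cycle yields for it.\<close>
  have robin: "\<bar>k n * y (cyc N (n - 1)) s + d1 n s\<bar> \<le> l * (K * exp (- \<sigma> * s))"
    if n: "n \<in> {1..N}" and s: "0 < s" "s \<le> t" and K: "k n / l * A' + D1 / l * X \<le> K"
      and A': "A (cyc N (n - 1)) \<le> A'" for n s K A'
  proof -
    have "\<bar>y (cyc N (n - 1)) s\<bar> \<le> A (cyc N (n - 1)) * exp (- \<sigma> * s)"
      using s by (intro A_ge[OF cyc[OF n]]) auto
    also have "\<dots> \<le> A' * exp (- \<sigma> * s)" using A' by simp
    finally have "k n / l * \<bar>y (cyc N (n - 1)) s\<bar> \<le> k n / l * (A' * exp (- \<sigma> * s))"
      using par(1)[OF n] params(3) by (intro mult_left_mono) auto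
    then have 1: "k n / l * \<bar>y (cyc N (n - 1)) s\<bar> \<le> (k n / l * A') * exp (- \<sigma> * s)" by (simp add: mult.assoc)
    have 2: "\<bar>d1 n s\<bar> / l \<le> D1 / l" using D1_ge[OF n, of s] s params(3) by (intro divide_right_mono) auto
    have "k n / l * \<bar>y (cyc N (n - 1)) s\<bar> + \<bar>d1 n s\<bar> / l \<le> K * exp (- \<sigma> * s)"
      using nonneg params(3) s by (intro weight2[OF 1 2 _ _ K]) auto
    then have "k n * \<bar>y (cyc N (n - 1)) s\<bar> + \<bar>d1 n s\<bar> \<le> l * (K * exp (- \<sigma> * s))"
      using params(3) by (simp add: field_simps)
    moreover have "\<bar>k n * y (cyc N (n - 1)) s\<bar> = k n * \<bar>y (cyc N (n - 1)) s\<bar>"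
      using par(1)[OF n] by (simp add: abs_mult)
    ultimately show ?thesis by linarith
  qed

  have A_step: "A n \<le> B + k n / l * A (cyc N (n - 1))" if n: "n \<in> {1..N}" for n
  proof -
    \<comment> \<open>The predecessor enters the problem for u - uref only through the Robin
      condition, where division by \<open>l\<close> gives the factor \<open>k n / l\<close>.\<close>
    define K where "K = B + k n / l * A (cyc N (n - 1))"
    have "0 \<le> A (cyc N (n - 1))" using A_ge[OF cyc[OF n], of 0] t by simp
    then have kA: "0 \<le> k n / l * A (cyc N (n - 1))" using par(1)[OF n] params(3) by simp
    have Sw: "strong_solution \<alpha> lam (f n) (\<lambda>x s. u n x s - uref x s)"
      using strong_solution_diff[OF Su[OF n] Sr] by simp
    have bound: "\<bar>u n x s - uref x s\<bar> \<le> K * exp (- \<sigma> * s)" if x: "x \<in> {0..1}" and s: "0 \<le> s" "s \<le> t" for x s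
    proof (rule strong_solution_decay[OF Sw par(2,3,4) _ _ _ _ s x])
      fix x s :: real assume "0 < x" "x < 1" "0 < s" "s \<le> t"
      then show "\<bar>f n x s\<bar> \<le> (lam - \<sigma>) * (K * exp (- \<sigma> * s))"
        using n KE_B kA by (intro source) (auto simp: K_def)
    next
      fix x :: real assume x: "0 < x" "x < 1"
      then have "u n x 0 - uref x 0 = u0 n x - uref0 x"
        using agent(4) reference(4) n by simp
      then show "\<bar>u n x 0 - uref x 0\<bar> \<le> K"
        using U_ge[OF n, of x] R0_ge[of x] x KE_B kA unfolding K_def by auto
    next
      fix s :: real assume s: "0 < s" "s \<le> t"
      have "\<bar>e n 0 s\<bar> + \<bar>d0 n s\<bar> \<le> K * exp (- \<sigma> * s)"
        using D0_ge[OF n, of s] e_bound[OF n, of 0 s] s nonneg KE_B kA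
        by (intro weight2[where c = D0 and ?K1.0 = KE]) (auto simp: K_def)
      moreover have "u n 0 s - uref 0 s = e n 0 s + d0 n s"
        using agent(2) reference(2) U0_eq[OF n] n s by simp
      ultimately show "\<bar>u n 0 s - uref 0 s\<bar> \<le> K * exp (- \<sigma> * s) \<or> dx (\<lambda>x. u n x s - uref x s) 0 = 0"
        by linarith
      have "dx (\<lambda>x. u n x s - uref x s) 1 + l * (u n 1 s - uref 1 s) = k n * y (cyc N (n - 1)) s + d1 n s"
        using dx_diff[OF Su[OF n] Sr, of s 1] agent(3) reference(3) controls(2) n s
        by (simp add: y_def algebra_simps)
      then show "\<bar>dx (\<lambda>x. u n x s - uref x s) 1 + l * (u n 1 s - uref 1 s)\<bar> \<le> l * (K * exp (- \<sigma> * s))"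
        using robin[OF n s, of "A (cyc N (n - 1))" K] KE_B by (simp add: K_def)
    qed
    have "\<bar>exp (\<sigma> * s) * y n s\<bar> \<le> K" if "s \<in> {0..t}" for s
    proof -
      have "exp (\<sigma> * s) * \<bar>y n s\<bar> \<le> exp (\<sigma> * s) * (K * exp (- \<sigma> * s))"
        using bound[of 1 s] that by (intro mult_left_mono) (auto simp: y_def)
      also have "\<dots> = K" by (simp add: exp_minus)
      finally show ?thesis by (simp only: abs_mult abs_exp_cancel)
    qed
    then show ?thesis unfolding A_def[of n] K_def[symmetric] using t by (intro C_norm_le) auto
  qed
  define j where "j = cyc N (i - 1)"
  define Ct where "Ct = Ct_const N l k i"
  have j: "j \<in> {1..N}" unfolding j_def by (rule cyc[OF i])
  \<comment> \<open>The origin of \<open>Ct_const\<close>: the agent's own data contribute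
    \<open>B\<close>, and the trace of its predecessor, bounded by
    \<open>C_const N l k j * B\<close>, contributes through the coupling gain.\<close>
  have Ct_eq: "Ct * B = B + k i / l * (C_const N l k j * B)"
    by (simp add: Ct_def Ct_const_def j_def algebra_simps)
  have Aj: "A j \<le> C_const N l k j * B"
    by (rule cyclic_gain_bound[where A = A, OF par(5) params(3) par(1) KE_B(5) A_step j])
  have "0 \<le> C_const N l k j * B" using C_const_nonneg[OF par(5) params(3) par(1) j] KE_B by simp
  then have CB: "0 \<le> k i / l * (C_const N l k j * B)" using par(1)[OF i] params(3) by simp
  have robin_i: "\<bar>U1 i s\<bar> \<le> l * (K * exp (- \<sigma> * s))" if s: "0 < s" "s \<le> t" and K: "Ct * B \<le> K" for s K
  proof -
    have "U1 i s = k i * y (cyc N (i - 1)) s + d1 i s" using controls(2) i s by (simp add: y_def)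
    then show ?thesis
      using robin[OF i s, of "C_const N l k j * B" K] Aj K KE_B unfolding Ct_eq j_def by simp
  qed
  have RX: "0 \<le> R * X" "0 \<le> Qi * X" using nonneg X0 by auto

  \<comment> \<open>Barriers for the four components and their sum\<close>
  define Ku where "Ku = R * X + Ct * B"
  have u_bound: "\<bar>u i x t\<bar> \<le> Ku * exp (- \<sigma> * t)" if x: "x \<in> {0..1}" for x
  proof (rule strong_solution_decay[OF Su[OF i] par(2,3,4) _ _ _ _ less_imp_le[OF t] order_refl x])
    fix x s :: real assume "0 < x" "x < 1" "0 < s" "s \<le> t"
    then show "\<bar>f i x s\<bar> \<le> (lam - \<sigma>) * (Ku * exp (- \<sigma> * s))"
      using i KE_B CB RX by (intro source) (auto simp: Ku_def Ct_eq)
  next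
    fix x :: real assume x: "0 < x" "x < 1"
    then have "u i x 0 = u0 i x" using agent(4) i by simp
    then show "\<bar>u i x 0\<bar> \<le> Ku"
      using U_ge[OF i, of x] x KE_B CB RX nonneg unfolding Ku_def Ct_eq by auto
  next
    fix s :: real assume s: "0 < s" "s \<le> t"
    have "\<bar>e i 0 s\<bar> + (\<bar>d0 i s\<bar> + \<bar>r s\<bar>) \<le> Ku * exp (- \<sigma> * s)"
      using D0_ge[OF i, of s] R_ge[of s] e_bound[OF i, of 0 s] s nonneg KE_B CB
      by (intro weight2[where c = "D0 + R" and ?K1.0 = KE]) (auto simp: Ku_def Ct_eq distrib_right)
    moreover have "u i 0 s = e i 0 s + d0 i s + r s"
      using agent(2) U0_eq[OF i] i s by simp
    ultimately show "\<bar>u i 0 s\<bar> \<le> Ku * exp (- \<sigma> * s) \<or> dx (\<lambda>x. u i x s) 0 = 0" by linarith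
    show "\<bar>dx (\<lambda>x. u i x s) 1 + l * u i 1 s\<bar> \<le> l * (Ku * exp (- \<sigma> * s))"
      using robin_i[OF s, of Ku] agent(3) i s RX by (simp add: Ku_def)
  qed

  define Kr where "Kr = R0 + R * X"
  have uref_bound: "\<bar>uref x t\<bar> \<le> Kr * exp (- \<sigma> * t)" if x: "x \<in> {0..1}" for x
  proof (rule strong_solution_decay[OF Sr par(2,3,4) _ _ _ _ less_imp_le[OF t] order_refl x])
    have Kr0: "0 \<le> Kr" unfolding Kr_def using nonneg RX by simp
    fix x s :: real assume "0 < x" "x < 1" "0 < s" "s \<le> t"
    then show "\<bar>0\<bar> \<le> (lam - \<sigma>) * (Kr * exp (- \<sigma> * s))" using Kr0 sigma by simp
  next
    fix x :: real assume x: "0 < x" "x < 1"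
    then show "\<bar>uref x 0\<bar> \<le> Kr" using R0_ge[of x] reference(4) RX by (simp add: Kr_def)
  next
    fix s :: real assume s: "0 < s" "s \<le> t"
    show "\<bar>uref 0 s\<bar> \<le> Kr * exp (- \<sigma> * s) \<or> dx (\<lambda>x. uref x s) 0 = 0"
      using R_ge[of s] reference(2) s nonneg by (intro disjI1 weight1[where c = R]) (auto simp: Kr_def)
    have "0 \<le> Kr" unfolding Kr_def using nonneg RX by simp
    then show "\<bar>dx (\<lambda>x. uref x s) 1 + l * uref 1 s\<bar> \<le> l * (Kr * exp (- \<sigma> * s))"
      using reference(3) s params(3) by simp
  qed

  \<comment> \<open>The value of \<open>v\<close> at x = 0 is the control \<open>U0\<close>, so
    \<open>U0_eq\<close> brings in both \<open>r\<close> and \<open>q\<close>; for \<open>u\<close>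
    the disturbance had cancelled.\<close>
  define Kv where "Kv = R * X + Qi * X + Ct * B"
  have v_bound: "\<bar>v i x t\<bar> \<le> Kv * exp (- \<sigma> * t)" if x: "x \<in> {0..1}" for x
  proof (rule strong_solution_decay[OF Sv[OF i] par(2,3,4) _ _ _ _ less_imp_le[OF t] order_refl x])
    have Kv0: "0 \<le> Kv" unfolding Kv_def Ct_eq using KE_B CB RX by simp
    fix x s :: real assume "0 < x" "x < 1" "0 < s" "s \<le> t"
    then show "\<bar>0\<bar> \<le> (lam - \<sigma>) * (Kv * exp (- \<sigma> * s))" using Kv0 sigma by simp
  next
    fix x :: real assume x: "0 < x" "x < 1"
    have "V \<le> KE" unfolding KE_def using nonneg FX by simp
    then show "\<bar>v i x 0\<bar> \<le> Kv"
      using V_ge[OF i, of x] auxiliary(4) i x KE_B CB RX unfolding Kv_def Ct_eq by auto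
  next
    fix s :: real assume s: "0 < s" "s \<le> t"
    have "\<bar>e i 0 s\<bar> + (\<bar>d0 i s\<bar> + \<bar>r s\<bar> + \<bar>q i s\<bar>) \<le> Kv * exp (- \<sigma> * s)"
      using D0_ge[OF i, of s] R_ge[of s] Qi_ge[of s] e_bound[OF i, of 0 s] s nonneg KE_B CB
      by (intro weight2[where c = "D0 + R + Qi" and ?K1.0 = KE]) (auto simp: Kv_def Ct_eq distrib_right)
    moreover have "v i 0 s = r s - q i s + e i 0 s + d0 i s"
      using auxiliary(2) U0_eq[OF i] i s by simp
    ultimately show "\<bar>v i 0 s\<bar> \<le> Kv * exp (- \<sigma> * s) \<or> dx (\<lambda>x. v i x s) 0 = 0" by linarith
    show "\<bar>dx (\<lambda>x. v i x s) 1 + l * v i 1 s\<bar> \<le> l * (Kv * exp (- \<sigma> * s))"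
      using robin_i[OF s, of Kv] auxiliary(3) i s RX by (simp add: Kv_def)
  qed

  \<comment> \<open>By \<open>qh_left\<close> the Dirichlet value of the observer is
    \<open>q\<close> up to the error \<open>e\<close>, so neither \<open>r\<close> nor the coupling
    enters.\<close>
  define Kq where "Kq = Qi * X + KE"
  have qh_bound: "\<bar>qh i x t\<bar> \<le> Kq * exp (- \<sigma> * t)" if x: "x \<in> {0..1}" for x
  proof (rule strong_solution_decay[OF Sq[OF i] par(2,3,4) _ _ _ _ less_imp_le[OF t] order_refl x])
    have Kq0: "0 \<le> Kq" unfolding Kq_def using KE0 RX by simp
    fix x s :: real assume "0 < x" "x < 1" "0 < s" "s \<le> t"
    then show "\<bar>0\<bar> \<le> (lam - \<sigma>) * (Kq * exp (- \<sigma> * s))" using Kq0 sigma by simp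
  next
    fix x :: real assume x: "0 < x" "x < 1"
    have "Q \<le> KE" unfolding KE_def using nonneg FX by simp
    then show "\<bar>qh i x 0\<bar> \<le> Kq"
      using Q_ge[OF i, of x] observer(4) i x RX unfolding Kq_def by auto
  next
    fix s :: real assume s: "0 < s" "s \<le> t"
    have "\<bar>e i 0 s\<bar> + \<bar>q i s\<bar> \<le> Kq * exp (- \<sigma> * s)"
      using Qi_ge[of s] e_bound[OF i, of 0 s] s nonneg
      by (intro weight2[where c = Qi and ?K1.0 = KE]) (auto simp: Kq_def)
    then show "\<bar>qh i 0 s\<bar> \<le> Kq * exp (- \<sigma> * s) \<or> dx (\<lambda>x. qh i x s) 0 = 0"
      using qh_left[OF i s(1)] by linarith
    have "0 \<le> Kq" unfolding Kq_def using KE0 RX by simp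
    then show "\<bar>dx (\<lambda>x. qh i x s) 1 + l * qh i 1 s\<bar> \<le> l * (Kq * exp (- \<sigma> * s))"
      using observer(3) i s params(3) by simp
  qed

  have "C_norm {0..1} (\<lambda>x. u i x t) + C_norm {0..1} (\<lambda>x. uref x t)
      + C_norm {0..1} (\<lambda>x. v i x t) + C_norm {0..1} (\<lambda>x. qh i x t)
    \<le> Ku * exp (- \<sigma> * t) + Kr * exp (- \<sigma> * t) + Kv * exp (- \<sigma> * t) + Kq * exp (- \<sigma> * t)"
    using u_bound uref_bound v_bound qh_bound by (intro add_mono C_norm_le) auto
  also have "\<dots> = (Ku + Kr + Kv + Kq) * exp (- \<sigma> * t)" by (simp add: distrib_right)
  also have "\<dots> \<le> ((1 + 2 * Ct) * (2 * U + R0) + (4 + 2 * Ct) * (V + Q)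
      + (3 * R + 2 * Qi + (1 + 2 * Ct) * D) * X) * exp (- \<sigma> * t)"
  proof (rule mult_right_mono)
    \<comment> \<open>The coefficients of the claim: \<open>r\<close> occurs in the barriers of
      \<open>u\<close>, \<open>uref\<close> and \<open>v\<close>, the disturbance in those of
      \<open>v\<close> and \<open>qh\<close>, and \<open>Ct * B\<close> in those of \<open>u\<close>
      and \<open>v\<close>. The remainder \<open>R0 + KE\<close> goes into the summands 1 and 4 of
      the prefactors.\<close>
    have "Ku + Kr + Kv + Kq = 3 * (R * X) + 2 * (Qi * X) + 2 * (Ct * B) + R0 + KE"
      by (simp add: Ku_def Kr_def Kv_def Kq_def)
    moreover have "KE + R0 \<le> (2 * U + R0) + 4 * (V + Q) + D * X"
      unfolding KE_def DX_eq using nonneg FX DX by simp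
    moreover have "2 * (Ct * B) + ((2 * U + R0) + 4 * (V + Q) + D * X) =
        (1 + 2 * Ct) * (2 * U + R0) + (4 + 2 * Ct) * (V + Q) + (1 + 2 * Ct) * (D * X)"
      unfolding B_def by (simp add: algebra_simps)
    ultimately show "Ku + Kr + Kv + Kq \<le> (1 + 2 * Ct) * (2 * U + R0) + (4 + 2 * Ct) * (V + Q)
      + (3 * R + 2 * Qi + (1 + 2 * Ct) * D) * X" by (simp add: algebra_simps)
  qed simp
  also have "\<dots> = (1 + 2 * Ct) * exp (- \<sigma> * t) * (2 * U + R0) + (4 + 2 * Ct) * exp (- \<sigma> * t) * (V + Q)
      + 3 * R + 2 * Qi + (1 + 2 * Ct) * D"
  proof -
    have Xe: "a * X * exp (- \<sigma> * t) = a" for a by (simp add: X_def exp_minus)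
    have E: "(a + b + c * X) * exp (- \<sigma> * t) = a * exp (- \<sigma> * t) + b * exp (- \<sigma> * t) + c" for a b c
      unfolding distrib_right Xe ..
    show ?thesis unfolding E by (simp add: mult_ac)
  qed
  finally show "C_norm {0..1} (\<lambda>x. u i x t) + C_norm {0..1} (\<lambda>x. uref x t)
      + C_norm {0..1} (\<lambda>x. v i x t) + C_norm {0..1} (\<lambda>x. qh i x t)
    \<le> (1 + 2 * Ct_const N l k i) * exp (- \<sigma> * t)
          * (2 * (MAX n\<in>{1..N}. C_norm {0..1} (u0 n)) + C_norm {0..1} uref0)
      + (4 + 2 * Ct_const N l k i) * exp (- \<sigma> * t)
          * ((MAX n\<in>{1..N}. C_norm {0..1} (v0 n)) + (MAX n\<in>{1..N}. C_norm {0..1} (qh0 n)))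
      + 3 * C_norm {0..t} r + 2 * C_norm {0..t} (q i)
      + (1 + 2 * Ct_const N l k i) * D_term N l lam \<sigma> f d0 d1 t"
    unfolding Ct_def U_def V_def Q_def R0_def R_def Qi_def D_def .
qed

end
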